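(* Let $\mathrm{EG}\subseteq\mathscr{G}$ be the set of elementary amenable marked groups. Then $\mathrm{EG}$ is co-analytic and not Borel in the space of marked groups $\mathscr{G}$, and the set $\mathrm{EG}\cap\mathscr{G}_{fg}$ of finitely generated elementary amenable marked groups is co-analytic and not Borel in $\mathscr{G}_{fg}$ (equivalently, in $\mathscr{G}$, since $\mathscr{G}_{fg}$ is a Borel subset of $\mathscr{G}$).
   Context: Let $\mathbb{F}_\omega$ be the free group on the letters $(a_i)_{i\in\mathbb{N}}$. The space of marked groups $\mathscr{G}$ is the set of normal subgroups $N$ of $\mathbb{F}_\omega$, a closed subset of $2^{\mathbb{F}_\omega}$ and hence a compact Polish space; $N$ is identified with the marked group $\mathbb{F}_\omega/N$, and an isomorphism-invariant class of countable groups is identified with the set of $N\in\mathscr{G}$ such that $\mathbb{F}_\omega/N$ belongs to the class. The space of finitely generated marked groups is $\mathscr{G}_{fg}=\bigcup_{m\ge1}\bigcap_{i\ge m}\{N\in\mathscr{G}\mid a_i\in N\}$; it is an $F_\sigma$ subset of $\mathscr{G}$ and is a standard Borel space whose Borel sets are the sets $B\cap\mathscr{G}_{fg}$ with $B\subseteq\mathscr{G}$ Borel. A subset of a standard Borel space $Y$ is analytic if it is the projection to $Y$ of a Borel subset of $X\times Y$ for some (uncountable) standard Borel space $X$; it is co-analytic if its complement is analytic. The class of elementary amenable groups is the smallest class of countable groups that contains all finite groups and all (countable) abelian groups and is closed under group extensions, countable increasing unions, taking subgroups, and taking quotients. *)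

theory Defs
  imports "HOL-Analysis.Analysis" "HOL-Algebra.Coset"
begin

section \<open>The free group on countably many letters\<close>

text \<open>The pair \<open>(i, True)\<close> stands for the letter \<open>a\<^sub>i\<close> and \<open>(i, False)\<close> for its inverse.
  Elements of the free group are the reduced words; they are multiplied by concatenation followed
  by free reduction.\<close>

type_synonym letter = "nat \<times> bool"

definition inv_letter :: "letter \<Rightarrow> letter" where
  "inv_letter x = (fst x, \<not> snd x)"

definition reduced :: "letter list \<Rightarrow> bool" where
  "reduced w \<longleftrightarrow> successively (\<lambda>x y. y \<noteq> inv_letter x) w"

fun push_letter :: "letter \<Rightarrow> letter list \<Rightarrow> letter list" where
  "push_letter x [] = [x]"
| "push_letter x (y # w) = (if y = inv_letter x then w else x # y # w)"

definition reduce :: "letter list \<Rightarrow> letter list" where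
  "reduce w = foldr push_letter w []"

definition free_group :: "letter list monoid" where
  "free_group = \<lparr>carrier = {w. reduced w}, mult = (\<lambda>u v. reduce (u @ v)), one = []\<rparr>"

definition gen :: "nat \<Rightarrow> letter list" where
  "gen i = [(i, True)]"

lemma inv_letter_inv_letter [simp]: "inv_letter (inv_letter x) = x"
  by (simp add: inv_letter_def)

lemma reduced_push_letter: "reduced w \<Longrightarrow> reduced (push_letter x w)"
  by (cases w) (auto simp: reduced_def successively_Cons)

lemma reduced_reduce: "reduced (reduce w)"
  unfolding reduce_def by (induction w) (simp_all add: reduced_push_letter, simp add: reduced_def)

lemma reduce_reduced: "reduced w \<Longrightarrow> reduce w = w"
proof (induction w)
  case (Cons x w)
  then have "reduce w = w" by (auto simp: reduced_def successively_Cons)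
  with Cons.prems show ?case
    by (cases w) (auto simp: reduce_def reduced_def)
qed (simp add: reduce_def)

lemma push_letter_inv:
  assumes "reduced w"
  shows "push_letter x (push_letter (inv_letter x) w) = w"
proof (cases w)
  case (Cons y v)
  with assms show ?thesis by (cases v) (auto simp: reduced_def)
qed simp

lemma reduce_append: "reduce (u @ v) = foldr push_letter u (reduce v)"
  by (simp add: reduce_def)

lemma foldr_push_letter_push_letter:
  assumes "reduced w" "reduced v"
  shows "foldr push_letter (push_letter x w) v = push_letter x (foldr push_letter w v)"
proof (cases w)
  case (Cons y w')
  have "reduced (foldr push_letter w' v)"
    using assms(2) by (induction w') (simp_all add: reduced_push_letter)
  with Cons show ?thesis using push_letter_inv[of "foldr push_letter w' v" x] by auto
qed simp

lemma foldr_push_letter_reduce: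
  assumes "reduced v"
  shows "foldr push_letter (reduce u) v = foldr push_letter u v"
proof (induction u)
  case (Cons x u)
  have "reduce (x # u) = push_letter x (reduce u)" by (simp add: reduce_def)
  with Cons assms show ?case
    by (simp add: foldr_push_letter_push_letter reduced_reduce)
qed (simp add: reduce_def)

lemma reduce_inverse_word: "reduce (rev (map inv_letter w) @ w) = []"
proof (induction w)
  case (Cons x w)
  have "push_letter (inv_letter x) (push_letter x (reduce w)) = reduce w"
    using push_letter_inv[OF reduced_reduce, of "inv_letter x"] by simp
  with Cons show ?case by (simp add: reduce_append) (simp add: reduce_def)
qed (simp add: reduce_def)

lemma group_free_group: "group free_group"
proof (rule groupI)
  fix u v w assume "u \<in> carrier free_group" "v \<in> carrier free_group" "w \<in> carrier free_group"
  have "reduce (reduce (u @ v) @ w) = foldr push_letter (reduce (u @ v)) (reduce w)"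
    by (rule reduce_append)
  also have "\<dots> = foldr push_letter (u @ v) (reduce w)"
    by (rule foldr_push_letter_reduce[OF reduced_reduce])
  also have "\<dots> = foldr push_letter u (reduce (reduce (v @ w)))"
    by (simp add: reduce_reduced[OF reduced_reduce]) (simp add: reduce_append)
  also have "\<dots> = reduce (u @ reduce (v @ w))"
    by (rule reduce_append[symmetric])
  finally have "reduce (reduce (u @ v) @ w) = reduce (u @ reduce (v @ w))" .
  then show "u \<otimes>\<^bsub>free_group\<^esub> v \<otimes>\<^bsub>free_group\<^esub> w = u \<otimes>\<^bsub>free_group\<^esub> (v \<otimes>\<^bsub>free_group\<^esub> w)"
    by (simp add: free_group_def)
next
  fix w assume w: "w \<in> carrier free_group"
  have "reduce (reduce (rev (map inv_letter w)) @ w) = []"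
    using w reduce_inverse_word[of w]
    by (simp add: free_group_def reduce_append foldr_push_letter_reduce reduced_reduce)
  then show "\<exists>v\<in>carrier free_group. v \<otimes>\<^bsub>free_group\<^esub> w = \<one>\<^bsub>free_group\<^esub>"
    by (intro bexI[of _ "reduce (rev (map inv_letter w))"])
       (simp_all add: free_group_def reduced_reduce)
qed (simp_all add: free_group_def reduced_reduce reduce_reduced, simp add: reduced_def)


section \<open>Standard Borel spaces, analytic and co-analytic sets\<close>

text \<open>Measurable spaces are represented by the library type \<^typ>\<open>'a measure\<close>, of which only
  \<open>space\<close> and \<open>sets\<close> matter here.\<close>

definition borel_of :: "'a topology \<Rightarrow> 'a measure" where
  "borel_of T = sigma (topspace T) {U. openin T U}"

definition standard_borel :: "'a measure \<Rightarrow> bool" where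
  "standard_borel M \<longleftrightarrow>
     (\<exists>T. completely_metrizable_space T \<and> second_countable T \<and> sets M = sets (borel_of T))"

text \<open>HOL cannot quantify over the type underlying the auxiliary space \<open>X\<close>. Since every standard
  Borel space has at most the cardinality of the continuum, each is isomorphic to one whose points
  form a set of functions \<^typ>\<open>nat \<Rightarrow> nat\<close>, so nothing is lost by fixing that type; the set of
  points and the Borel structure on it remain arbitrary.\<close>

definition analytic_in :: "'a measure \<Rightarrow> 'a set \<Rightarrow> bool" where
  "analytic_in Y A \<longleftrightarrow>
     (\<exists>(X :: (nat \<Rightarrow> nat) measure) B. standard_borel X \<and> uncountable (space X) \<and>
        B \<in> sets (X \<Otimes>\<^sub>M Y) \<and> A = snd ` B)"

definition co_analytic_in :: "'a measure \<Rightarrow> 'a set \<Rightarrow> bool" where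
  "co_analytic_in Y A \<longleftrightarrow> A \<subseteq> space Y \<and> analytic_in Y (space Y - A)"


section \<open>The spaces of marked groups\<close>

text \<open>The topology of \<open>2\<^sup>S\<close> carried over to \<^term>\<open>Pow S\<close> along characteristic functions.\<close>

definition powerset_topology :: "'a set \<Rightarrow> 'a set topology" where
  "powerset_topology S =
     pullback_topology (Pow S) (\<lambda>A. \<lambda>x\<in>S. x \<in> A)
       (product_topology (\<lambda>_. discrete_topology (UNIV :: bool set)) S)"

definition marked_groups :: "letter list set set" where
  "marked_groups = {N. N \<lhd> free_group}"

definition marked_groups_topology :: "letter list set topology" where
  "marked_groups_topology = subtopology (powerset_topology (carrier free_group)) marked_groups"

definition marked_groups_borel :: "letter list set measure" where
  "marked_groups_borel = borel_of marked_groups_topology"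

definition fg_marked_groups :: "letter list set set" where
  "fg_marked_groups = (\<Union>m\<in>{1..}. \<Inter>i\<in>{m..}. {N \<in> marked_groups. gen i \<in> N})"

definition fg_marked_groups_borel :: "letter list set measure" where
  "fg_marked_groups_borel = restrict_space marked_groups_borel fg_marked_groups"

lemma topspace_marked_groups_topology: "topspace marked_groups_topology = marked_groups"
  by (auto simp: marked_groups_topology_def powerset_topology_def topspace_pullback_topology
      marked_groups_def dest: normal_imp_subgroup subgroup.subset)

lemma space_marked_groups_borel: "space marked_groups_borel = marked_groups"
  by (metis (no_types, lifting) borel_of_def marked_groups_borel_def mem_Collect_eq openin_subset
      PowI subsetI space_measure_of topspace_marked_groups_topology)

lemma space_fg_marked_groups_borel: "space fg_marked_groups_borel = fg_marked_groups"
  by (auto simp: fg_marked_groups_borel_def space_restrict_space space_marked_groups_borel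
      fg_marked_groups_def)


section \<open>Elementary amenable groups\<close>

text \<open>A class of countable groups is represented by its members with carrier a subset of
  \<^typ>\<open>nat\<close>; every countable group is isomorphic to such a group, and the class is closed under
  isomorphism. As the quotient \<open>G Mod N\<close> has sets of numbers as elements, it enters the rules
  through an isomorphic group \<open>Q\<close> on \<^typ>\<open>nat\<close>.\<close>

inductive elementary_amenable_nat :: "nat monoid \<Rightarrow> bool" where
  finite: "group G \<Longrightarrow> finite (carrier G) \<Longrightarrow> elementary_amenable_nat G"
| abelian: "comm_group G \<Longrightarrow> elementary_amenable_nat G"
| iso: "elementary_amenable_nat G \<Longrightarrow> group H \<Longrightarrow> G \<cong> H \<Longrightarrow> elementary_amenable_nat H"
| extension: "N \<lhd> G \<Longrightarrow> elementary_amenable_nat (G\<lparr>carrier := N\<rparr>) \<Longrightarrow>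
    elementary_amenable_nat Q \<Longrightarrow> G Mod N \<cong> Q \<Longrightarrow> elementary_amenable_nat G"
| increasing_union: "group G \<Longrightarrow> (\<And>n::nat. subgroup (H n) G) \<Longrightarrow> incseq H \<Longrightarrow>
    carrier G = (\<Union>n. H n) \<Longrightarrow> (\<And>n. elementary_amenable_nat (G\<lparr>carrier := H n\<rparr>)) \<Longrightarrow>
    elementary_amenable_nat G"
| subgroup: "elementary_amenable_nat G \<Longrightarrow> subgroup H G \<Longrightarrow>
    elementary_amenable_nat (G\<lparr>carrier := H\<rparr>)"
| quotient: "elementary_amenable_nat G \<Longrightarrow> N \<lhd> G \<Longrightarrow> group Q \<Longrightarrow> G Mod N \<cong> Q \<Longrightarrow>
    elementary_amenable_nat Q"

definition elementary_amenable :: "('a, 'b) monoid_scheme \<Rightarrow> bool" where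
  "elementary_amenable G \<longleftrightarrow> group G \<and> (\<exists>H. elementary_amenable_nat H \<and> G \<cong> H)"

definition EG :: "letter list set set" where
  "EG = {N \<in> marked_groups. elementary_amenable (free_group Mod N)}"

end

(* A countable group is not elementary amenable iff it carries a nonempty family of finite subsets S,
   none trivial, such that every normal subgroup of <S> with finite or abelian quotient contains
   a member of the family. Soundness is an induction over the closure rules, since such
   families restrict to subgroups, push forward along homomorphisms that kill no member, and pull
   back; conversely the generating sets of the finitely generated subgroups that are not elementary
   amenable form such a family. For quotients F/N the family can be lifted to the free group F, where
   its defining property does not involve N. As finite index subgroups of finitely generated groups
   are finitely generated, the property is Borel, so the complement of EG is analytic.

   For non-Borelness, every node a of a countable graph gets a two-generated permutation group: the
   first generator t shifts a Z-indexed sequence of blocks, and the second generator u acts in two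
   sparse blocks as the two generators of each child. If a lies in the well-founded part, its group is
   elementary amenable: modulo the elements of shift 0 it is abelian, those are abelian modulo the
   finitely supported ones, and the latter are iterated extensions of groups of children. If a is ill-founded, commutators [z, t^R] with suitable conjugates z of u lie in every
   such normal subgroup and act on one block like the generators of an ill-founded child, which
   yields a family as above. So well-foundedness, which is not Borel by diagonalisation over Suslin
   codes, reduces to EG. *)
theory Submission
  imports Defs "HOL-Algebra.Elementary_Groups"
begin

section \<open>Certificates against elementary amenability\<close>

text \<open>\<open>M\<close> is a normal subgroup of \<open>L\<close> whose quotient \<open>L/M\<close> is abelian or finite; \<open>C\<close> contains a set
  of coset representatives.\<close>

definition fin_ab_normal :: "('a, 'b) monoid_scheme \<Rightarrow> 'a set \<Rightarrow> 'a set \<Rightarrow> bool" where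
  "fin_ab_normal G L M \<longleftrightarrow> subgroup M G \<and> M \<subseteq> L \<and>
     (\<forall>x\<in>L. \<forall>m\<in>M. x \<otimes>\<^bsub>G\<^esub> m \<otimes>\<^bsub>G\<^esub> inv\<^bsub>G\<^esub> x \<in> M) \<and>
     ((\<forall>x\<in>L. \<forall>y\<in>L. x \<otimes>\<^bsub>G\<^esub> y \<otimes>\<^bsub>G\<^esub> inv\<^bsub>G\<^esub> x \<otimes>\<^bsub>G\<^esub> inv\<^bsub>G\<^esub> y \<in> M) \<or>
      (\<exists>C. finite C \<and> C \<subseteq> L \<and> (\<forall>x\<in>L. \<exists>c\<in>C. x \<otimes>\<^bsub>G\<^esub> inv\<^bsub>G\<^esub> c \<in> M)))"

text \<open>A nonempty persistent family is a certificate that the group is not elementary amenable: whatever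
  finite or abelian quotient of the finitely generated group \<open>\<langle>S\<rangle>\<close> is taken, a member of the family
  survives in the kernel.\<close>

definition persistent :: "('a, 'b) monoid_scheme \<Rightarrow> 'a set set \<Rightarrow> bool" where
  "persistent G \<F> \<longleftrightarrow> (\<forall>S\<in>\<F>. finite S \<and> S \<subseteq> carrier G \<and> \<not> S \<subseteq> {\<one>\<^bsub>G\<^esub>} \<and>
     (\<forall>M. fin_ab_normal G (generate G S) M \<longrightarrow> (\<exists>S'\<in>\<F>. S' \<subseteq> M)))"

lemma persistentD:
  assumes "persistent G \<F>" "S \<in> \<F>"
  shows "finite S" "S \<subseteq> carrier G" "\<not> S \<subseteq> {\<one>\<^bsub>G\<^esub>}"
    "fin_ab_normal G (generate G S) M \<Longrightarrow> \<exists>S'\<in>\<F>. S' \<subseteq> M"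
  using assms unfolding persistent_def by blast+

lemma fin_ab_normalI:
  assumes "subgroup M G" "M \<subseteq> L"
    and "\<And>x m. x \<in> L \<Longrightarrow> m \<in> M \<Longrightarrow> x \<otimes>\<^bsub>G\<^esub> m \<otimes>\<^bsub>G\<^esub> inv\<^bsub>G\<^esub> x \<in> M"
    and "(\<forall>x\<in>L. \<forall>y\<in>L. x \<otimes>\<^bsub>G\<^esub> y \<otimes>\<^bsub>G\<^esub> inv\<^bsub>G\<^esub> x \<otimes>\<^bsub>G\<^esub> inv\<^bsub>G\<^esub> y \<in> M) \<or>
      (\<exists>C. finite C \<and> C \<subseteq> L \<and> (\<forall>x\<in>L. \<exists>c\<in>C. x \<otimes>\<^bsub>G\<^esub> inv\<^bsub>G\<^esub> c \<in> M))"
  shows "fin_ab_normal G L M"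
  using assms unfolding fin_ab_normal_def by metis

lemma fin_ab_normalD:
  assumes "fin_ab_normal G L M"
  shows "subgroup M G" "M \<subseteq> L"
    "x \<in> L \<Longrightarrow> m \<in> M \<Longrightarrow> x \<otimes>\<^bsub>G\<^esub> m \<otimes>\<^bsub>G\<^esub> inv\<^bsub>G\<^esub> x \<in> M"
  using assms unfolding fin_ab_normal_def by simp_all

lemma fin_ab_normalE:
  assumes "fin_ab_normal G L M"
  obtains (abelian) "\<And>x y. x \<in> L \<Longrightarrow> y \<in> L \<Longrightarrow> x \<otimes>\<^bsub>G\<^esub> y \<otimes>\<^bsub>G\<^esub> inv\<^bsub>G\<^esub> x \<otimes>\<^bsub>G\<^esub> inv\<^bsub>G\<^esub> y \<in> M"
  | (finite) C where "finite C" "C \<subseteq> L" "\<And>x. x \<in> L \<Longrightarrow> \<exists>c\<in>C. x \<otimes>\<^bsub>G\<^esub> inv\<^bsub>G\<^esub> c \<in> M"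
  using assms unfolding fin_ab_normal_def by metis

section \<open>Certificates under restriction, image and preimage\<close>

lemma (in group) fin_ab_normal_restrict_iff:
  assumes H: "subgroup H G" and LH: "L \<subseteq> H"
  shows "fin_ab_normal (G\<lparr>carrier := H\<rparr>) L M \<longleftrightarrow> fin_ab_normal G L M"
proof -
  have i: "inv\<^bsub>G\<lparr>carrier := H\<rparr>\<^esub> x = inv x" if "x \<in> L" for x
    using m_inv_consistent[OF H, of x] that LH by auto
  have s: "subgroup M (G\<lparr>carrier := H\<rparr>) \<longleftrightarrow> subgroup M G" if "M \<subseteq> L"
    using incl_subgroup[OF H] subgroup_incl[OF _ H] that LH by blast
  have b: "(\<exists>c\<in>C. x \<otimes> inv\<^bsub>G\<lparr>carrier := H\<rparr>\<^esub> c \<in> M) \<longleftrightarrow> (\<exists>c\<in>C. x \<otimes> inv c \<in> M)" if "C \<subseteq> L" for C x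
    by (rule bex_cong[OF refl]) (use i that in \<open>simp add: subset_iff\<close>)
  have c: "(\<exists>C. finite C \<and> C \<subseteq> L \<and> (\<forall>x\<in>L. \<exists>c\<in>C. x \<otimes> inv\<^bsub>G\<lparr>carrier := H\<rparr>\<^esub> c \<in> M)) \<longleftrightarrow>
      (\<exists>C. finite C \<and> C \<subseteq> L \<and> (\<forall>x\<in>L. \<exists>c\<in>C. x \<otimes> inv c \<in> M))"
    by (simp add: b cong: conj_cong)
  show ?thesis
    unfolding fin_ab_normal_def by (simp add: i b cong: conj_cong ball_cong) (use s in blast)
qed

text \<open>If \<open>S\<close> lies in \<open>H\<close>, so does the group it generates and hence
  every kernel \<open>M\<close> that is tested; the member found inside \<open>M\<close> therefore
  lies in \<open>H\<close> again.\<close>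

lemma (in group) persistent_subgroup:
  assumes H: "subgroup H G" and F: "persistent G \<F>"
  shows "persistent (G\<lparr>carrier := H\<rparr>) {S\<in>\<F>. S \<subseteq> H}"
  unfolding persistent_def
proof (intro ballI conjI allI impI)
  fix S assume S: "S \<in> {S\<in>\<F>. S \<subseteq> H}"
  then have S': "S \<in> \<F>" "S \<subseteq> H" by auto
  show "finite S" "S \<subseteq> carrier (G\<lparr>carrier := H\<rparr>)" "\<not> S \<subseteq> {\<one>\<^bsub>G\<lparr>carrier := H\<rparr>\<^esub>}"
    using persistentD[OF F S'(1)] S' by auto
  fix M assume M: "fin_ab_normal (G\<lparr>carrier := H\<rparr>) (generate (G\<lparr>carrier := H\<rparr>) S) M"
  have gen: "generate (G\<lparr>carrier := H\<rparr>) S = generate G S"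
    by (rule generate_consistent[OF S'(2) H])
  have le: "generate G S \<subseteq> H" by (rule generate_subgroup_incl[OF S'(2) H])
  have MG: "fin_ab_normal G (generate G S) M"
    using fin_ab_normal_restrict_iff[OF H le] M gen by simp
  then obtain S1 where "S1 \<in> \<F>" "S1 \<subseteq> M" using persistentD(4)[OF F S'(1)] by blast
  moreover have "M \<subseteq> H" using fin_ab_normalD(2)[OF MG] le by blast
  ultimately show "\<exists>S'\<in>{S\<in>\<F>. S \<subseteq> H}. S' \<subseteq> M" by blast
qed

lemma (in group_hom) fin_ab_normal_vimage:
  assumes L: "subgroup L G" and M: "fin_ab_normal H (h ` L) M"
  shows "fin_ab_normal G L {x\<in>L. h x \<in> M}"
proof (rule fin_ab_normalI)
  interpret L: subgroup L G by (rule L)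
  note MD = fin_ab_normalD[OF M]
  interpret M: subgroup M H by (rule MD(1))
  have [simp]: "x \<in> carrier G" if "x \<in> L" for x using that L.subset by auto
  show "subgroup {x\<in>L. h x \<in> M} G" by unfold_locales auto
  show "x \<otimes> m \<otimes> inv x \<in> {x\<in>L. h x \<in> M}" if "x \<in> L" "m \<in> {x\<in>L. h x \<in> M}" for x m
    using MD(3)[of "h x" "h m"] that by simp
  show "(\<forall>x\<in>L. \<forall>y\<in>L. x \<otimes> y \<otimes> inv x \<otimes> inv y \<in> {x\<in>L. h x \<in> M}) \<or>
      (\<exists>C. finite C \<and> C \<subseteq> L \<and> (\<forall>x\<in>L. \<exists>c\<in>C. x \<otimes> inv c \<in> {x\<in>L. h x \<in> M}))"
    using M
  proof (cases rule: fin_ab_normalE)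
    case abelian
    have "x \<otimes> y \<otimes> inv x \<otimes> inv y \<in> {x\<in>L. h x \<in> M}" if "x \<in> L" "y \<in> L" for x y
      using abelian[of "h x" "h y"] that by simp
    then show ?thesis by blast
  next
    case (finite C)
    \<comment> \<open>The coset representatives upstairs are chosen preimages of the finitely many
      representatives downstairs.\<close>
    obtain D where D: "D \<subseteq> L" "finite D" "C = h ` D" using finite_subset_image[OF finite(1,2)] by blast
    have "\<exists>c\<in>D. x \<otimes> inv c \<in> {x\<in>L. h x \<in> M}" if x: "x \<in> L" for x
    proof -
      obtain d where d: "d \<in> D" "h x \<otimes>\<^bsub>H\<^esub> inv\<^bsub>H\<^esub> h d \<in> M" using finite(3) D(3) x by blast
      then have "d \<in> L" using D(1) by blast
      with d x show ?thesis by (intro bexI[of _ d]) simp_all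
    qed
    with D show ?thesis by blast
  qed
qed auto

lemma (in group_hom) fin_ab_normal_image:
  assumes L: "subgroup L G" and M: "fin_ab_normal G L M"
  shows "fin_ab_normal H (h ` L) (h ` M)"
proof (rule fin_ab_normalI)
  note MD = fin_ab_normalD[OF M]
  have [simp]: "x \<in> carrier G" if "x \<in> L" for x using that subgroup.subset[OF L] by auto
  have [simp]: "x \<in> carrier G" if "x \<in> M" for x using that MD(2) by auto
  show "subgroup (h ` M) H" by (rule subgroup_img_is_subgroup[OF MD(1)])
  show "h ` M \<subseteq> h ` L" using MD(2) by blast
  show "x \<otimes>\<^bsub>H\<^esub> m \<otimes>\<^bsub>H\<^esub> inv\<^bsub>H\<^esub> x \<in> h ` M" if "x \<in> h ` L" "m \<in> h ` M" for x m
  proof -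
    from that obtain a b where ab: "a \<in> L" "b \<in> M" "x = h a" "m = h b" by blast
    have "h (a \<otimes> b \<otimes> inv a) \<in> h ` M" using MD(3)[OF ab(1,2)] by blast
    then show ?thesis using ab by simp
  qed
  show "(\<forall>x\<in>h ` L. \<forall>y\<in>h ` L. x \<otimes>\<^bsub>H\<^esub> y \<otimes>\<^bsub>H\<^esub> inv\<^bsub>H\<^esub> x \<otimes>\<^bsub>H\<^esub> inv\<^bsub>H\<^esub> y \<in> h ` M) \<or>
      (\<exists>C. finite C \<and> C \<subseteq> h ` L \<and> (\<forall>x\<in>h ` L. \<exists>c\<in>C. x \<otimes>\<^bsub>H\<^esub> inv\<^bsub>H\<^esub> c \<in> h ` M))"
    using M
  proof (cases rule: fin_ab_normalE)
    case abelian
    have "x \<otimes>\<^bsub>H\<^esub> y \<otimes>\<^bsub>H\<^esub> inv\<^bsub>H\<^esub> x \<otimes>\<^bsub>H\<^esub> inv\<^bsub>H\<^esub> y \<in> h ` M" if "x \<in> h ` L" "y \<in> h ` L" for x y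
    proof -
      from that obtain a b where ab: "a \<in> L" "b \<in> L" "x = h a" "y = h b" by blast
      have "h (a \<otimes> b \<otimes> inv a \<otimes> inv b) \<in> h ` M" using abelian[OF ab(1,2)] by blast
      then show ?thesis using ab by simp
    qed
    then show ?thesis by blast
  next
    case (finite C)
    have "\<exists>c\<in>h ` C. h x \<otimes>\<^bsub>H\<^esub> inv\<^bsub>H\<^esub> c \<in> h ` M" if x: "x \<in> L" for x
    proof -
      obtain c where c: "c \<in> C" "x \<otimes> inv c \<in> M" using finite(3)[OF x] by blast
      then have "h (x \<otimes> inv c) \<in> h ` M" by blast
      moreover have "c \<in> L" using c finite by auto
      ultimately show ?thesis using c x by (intro bexI[of _ "h c"]) auto
    qed
    then show ?thesis using finite by (intro disjI2 exI[of _ "h ` C"]) auto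
  qed
qed

text \<open>A test kernel \<open>M\<close> in the image pulls back to a test kernel in the group
  generated by \<open>S\<close>, and the member found there is mapped into \<open>M\<close>. The
  hypothesis on the kernel of \<open>h\<close> prevents members from becoming trivial.\<close>

lemma (in group_hom) persistent_image:
  assumes F: "persistent G \<F>" and nt: "\<And>S. S \<in> \<F> \<Longrightarrow> \<not> S \<subseteq> kernel G H h"
  shows "persistent H ((`) h ` \<F>)"
  unfolding persistent_def
proof (intro ballI conjI allI impI)
  fix T assume "T \<in> (`) h ` \<F>"
  then obtain S where S: "S \<in> \<F>" "T = h ` S" by blast
  note SD = persistentD[OF F S(1)]
  show "finite T" "T \<subseteq> carrier H" using SD S by auto
  show "\<not> T \<subseteq> {\<one>\<^bsub>H\<^esub>}" using nt[OF S(1)] SD(2) S(2) by (auto simp: kernel_def)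
  fix M assume M: "fin_ab_normal H (generate H T) M"
  have "generate H T = h ` generate G S" using generate_img[OF SD(2)] S(2) by simp
  then have "fin_ab_normal G (generate G S) {x \<in> generate G S. h x \<in> M}"
    using fin_ab_normal_vimage[OF G.generate_is_subgroup[OF SD(2)]] M by simp
  from SD(4)[OF this] obtain S1 where "S1 \<in> \<F>" "S1 \<subseteq> {x \<in> generate G S. h x \<in> M}" by blast
  then show "\<exists>S'\<in>(`) h ` \<F>. S' \<subseteq> M" by blast
qed

text \<open>Here test kernels are pushed forward. The member found inside the image of
  \<open>M\<close> is finite, so it is the image of a finite subset of \<open>M\<close>; this is why
  the pulled back family contains all finite lifts.\<close>

lemma (in group_hom) persistent_vimage:
  assumes F: "persistent H \<F>"
  shows "persistent G {S. finite S \<and> S \<subseteq> carrier G \<and> h ` S \<in> \<F>}"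
  unfolding persistent_def
proof (intro ballI conjI allI impI)
  fix S assume "S \<in> {S. finite S \<and> S \<subseteq> carrier G \<and> h ` S \<in> \<F>}"
  then have S: "finite S" "S \<subseteq> carrier G" "h ` S \<in> \<F>" by auto
  note SD = persistentD[OF F S(3)]
  show "finite S" "S \<subseteq> carrier G" by fact+
  show "\<not> S \<subseteq> {\<one>}" using SD(3) by auto
  fix M assume M: "fin_ab_normal G (generate G S) M"
  have "fin_ab_normal H (generate H (h ` S)) (h ` M)"
    using fin_ab_normal_image[OF G.generate_is_subgroup[OF S(2)] M] generate_img[OF S(2)] by simp
  from SD(4)[OF this] obtain T where T: "T \<in> \<F>" "T \<subseteq> h ` M" by blast
  have "finite T" using persistentD(1)[OF F T(1)] .
  from finite_subset_image[OF this T(2)] obtain S1 where "S1 \<subseteq> M" "finite S1" "T = h ` S1" by blast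
  moreover have "M \<subseteq> carrier G"
    using fin_ab_normalD(1)[OF M] by (rule subgroup.subset)
  ultimately show "\<exists>S'\<in>{S. finite S \<and> S \<subseteq> carrier G \<and> h ` S \<in> \<F>}. S' \<subseteq> M" using T by blast
qed

section \<open>Soundness of certificates\<close>

lemma finite_subset_incseq:
  assumes "finite S" "S \<subseteq> (\<Union>n. H n)" "incseq H"
  obtains n :: nat where "S \<subseteq> H n"
proof -
  obtain f where f: "x \<in> H (f x)" if "x \<in> S" for x
    using assms(2) by (metis UN_iff subsetD)
  have "x \<in> H (Max (f ` S))" if "x \<in> S" for x
  proof -
    have "f x \<le> Max (f ` S)" using assms(1) that by simp
    then show ?thesis using incseqD[OF assms(3)] f[OF that] by blast
  qed
  then show ?thesis using that by blast
qed

lemma isoE_group_hom: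
  assumes "group G" "group H" "G \<cong> H"
  obtains h where "group_hom G H h" "h ` carrier G = carrier H" "inj_on h (carrier G)"
  using assms unfolding is_iso_def iso_def group_hom_def group_hom_axioms_def bij_betw_def by blast

text \<open>The trivial subgroup is itself a test kernel, so a member of the family would have to
  lie in it. The abelian case uses the same kernel.\<close>

lemma (in group) persistent_finite:
  assumes "finite (carrier G)" and F: "persistent G \<F>"
  shows "\<F> = {}"
proof -
  have False if S: "S \<in> \<F>" for S
  proof -
    have SG: "S \<subseteq> carrier G" using persistentD(2)[OF F S] .
    note g = generate_is_subgroup[OF SG]
    have "finite (generate G S)" using assms(1) generate_incl[OF SG] by (rule rev_finite_subset)
    then have "fin_ab_normal G (generate G S) {\<one>}"
      using triv_subgroup subgroup.one_closed[OF g] subgroup.mem_carrier[OF g]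
      by (intro fin_ab_normalI disjI2 exI[of _ "generate G S"]) (auto intro: r_inv)
    from persistentD(4)[OF F S this] show False using persistentD(3)[OF F] by blast
  qed
  then show ?thesis by blast
qed

lemma (in comm_group) persistent_empty:
  assumes F: "persistent G \<F>"
  shows "\<F> = {}"
proof -
  have False if S: "S \<in> \<F>" for S
  proof -
    have SG: "S \<subseteq> carrier G" using persistentD(2)[OF F S] .
    note g = generate_is_subgroup[OF SG]
    have "x \<otimes> y \<otimes> inv x \<otimes> inv y = \<one>" if "x \<in> carrier G" "y \<in> carrier G" for x y
      using that by (metis inv_closed inv_solve_right m_closed m_comm r_inv)
    then have "fin_ab_normal G (generate G S) {\<one>}"
      using triv_subgroup subgroup.one_closed[OF g] subgroup.mem_carrier[OF g]
      by (intro fin_ab_normalI disjI1) auto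
    from persistentD(4)[OF F S this] show False using persistentD(3)[OF F] by blast
  qed
  then show ?thesis by blast
qed

lemma elementary_amenable_nat_group: "elementary_amenable_nat G \<Longrightarrow> group G"
proof (induction rule: elementary_amenable_nat.induct)
  case (abelian G) then show ?case by (simp add: comm_group_def)
next
  case (subgroup G H) then show ?case using subgroup.subgroup_is_group by blast
qed (auto dest: normal.axioms)

lemma elementary_amenable_nat_persistent:
  "elementary_amenable_nat G \<Longrightarrow> persistent G \<F> \<Longrightarrow> \<F> = {}"
proof (induction arbitrary: \<F> rule: elementary_amenable_nat.induct)
  case (finite G)
  then show ?case by (rule group.persistent_finite)
next
  case (abelian G)
  then show ?case by (rule comm_group.persistent_empty)
next
  case (iso G H)
  have G: "group G" by (rule elementary_amenable_nat_group) fact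
  obtain h where h: "group_hom H G h" "inj_on h (carrier H)"
    using isoE_group_hom[OF iso.hyps(2) G group.iso_sym[OF G iso.hyps(3)]] by blast
  have "persistent G ((`) h ` \<F>)"
  proof (rule group_hom.persistent_image[OF h(1) iso.prems])
    fix S assume "S \<in> \<F>"
    then show "\<not> S \<subseteq> kernel H G h"
      using persistentD(3)[OF iso.prems] group_hom.inj_iff_trivial_ker[OF h(1)] h(2) by auto
  qed
  then show ?case using iso.IH by blast
next
  case (extension N G Q)
  interpret normal N G by fact
  have Q: "group Q" by (rule elementary_amenable_nat_group) fact
  obtain h where h: "group_hom (G Mod N) Q h" "inj_on h (carrier (G Mod N))"
    using isoE_group_hom[OF factorgroup_is_group Q extension.hyps(4)] by metis
  interpret h: group_hom "G Mod N" Q h by (rule h(1))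
  have hom: "group_hom G Q (h \<circ> (\<lambda>a. N #>\<^bsub>G\<^esub> a))"
    by unfold_locales (rule Group.hom_compose[OF r_coset_hom_Mod h.homh])
  have ker: "kernel G Q (h \<circ> (\<lambda>a. N #>\<^bsub>G\<^esub> a)) \<subseteq> N"
  proof
    fix a assume "a \<in> kernel G Q (h \<circ> (\<lambda>a. N #>\<^bsub>G\<^esub> a))"
    then have a: "a \<in> carrier G" "h (N #>\<^bsub>G\<^esub> a) = h (\<one>\<^bsub>G Mod N\<^esub>)"
      using h.hom_one by (auto simp: kernel_def simp del: h.hom_one)
    have "N #>\<^bsub>G\<^esub> a \<in> carrier (G Mod N)" using a(1) by (auto simp: FactGroup_def RCOSETS_def)
    from inj_onD[OF h(2) a(2) this h.G.one_closed] have "N #>\<^bsub>G\<^esub> a = N"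
      by (simp add: FactGroup_def)
    then show "a \<in> N" using a(1) rcos_self[OF a(1) is_subgroup] by simp
  qed
  \<comment> \<open>The members inside \<open>N\<close> form a persistent family of
    \<open>N\<close>, which is empty by induction. So no member dies in the quotient, and the family
    can be pushed forward to \<open>Q\<close>.\<close>
  have "\<not> S \<subseteq> N" if "S \<in> \<F>" for S
    using extension.IH(1)[OF persistent_subgroup[OF is_subgroup extension.prems]] that by blast
  then have "persistent Q ((`) (h \<circ> (\<lambda>a. N #>\<^bsub>G\<^esub> a)) ` \<F>)"
    using ker by (intro group_hom.persistent_image[OF hom extension.prems]) blast
  then show ?case using extension.IH(2) by blast
next
  case (increasing_union G H)
  \<comment> \<open>A member is finite, so it lies in one stage of the union and contradicts the
    induction hypothesis for that stage.\<close>
  have False if S: "S \<in> \<F>" for S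
  proof -
    have "S \<subseteq> (\<Union>n. H n)" "finite S"
      using persistentD(1,2)[OF increasing_union.prems S] increasing_union.hyps(4) by auto
    then obtain n where "S \<subseteq> H n"
      using finite_subset_incseq[OF _ _ increasing_union.hyps(3)] by blast
    then show False
      using increasing_union.IH[OF group.persistent_subgroup[OF increasing_union.hyps(1,2)
          increasing_union.prems]] S by blast
  qed
  then show ?case by blast
next
  case (subgroup G H)
  interpret group G by (rule elementary_amenable_nat_group) fact
  interpret i: group_hom "G\<lparr>carrier := H\<rparr>" G "\<lambda>x. x"
    by (intro group_hom.intro group_hom_axioms.intro subgroup_imp_group subgroup.hyps(2) is_group)
       (use subgroup.subset[OF subgroup.hyps(2)] in \<open>auto simp: hom_def\<close>)
  have "persistent G ((`) (\<lambda>x. x) ` \<F>)"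
  proof (rule i.persistent_image[OF subgroup.prems])
    fix S assume S: "S \<in> \<F>"
    show "\<not> S \<subseteq> kernel (G\<lparr>carrier := H\<rparr>) G (\<lambda>x. x)"
      using persistentD(3)[OF subgroup.prems S] by (auto simp: kernel_def)
  qed
  then show ?case using subgroup.IH by blast
next
  case (quotient G N Q)
  interpret normal N G by fact
  obtain h where h: "group_hom (G Mod N) Q h" "h ` carrier (G Mod N) = carrier Q"
    using isoE_group_hom[OF factorgroup_is_group quotient.hyps(3,4)] by metis
  interpret h: group_hom "G Mod N" Q h by (rule h(1))
  let ?h = "h \<circ> (\<lambda>a. N #>\<^bsub>G\<^esub> a)"
  have hom: "group_hom G Q ?h"
    by unfold_locales (rule Group.hom_compose[OF r_coset_hom_Mod h.homh])
  have surj: "?h ` carrier G = carrier Q"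
    using h(2) by (auto simp: FactGroup_def RCOSETS_def image_comp [symmetric])
  \<comment> \<open>The family is pulled back to \<open>G\<close>. The pullback is nonempty because
    the finite member \<open>S\<close> lifts along the surjection onto \<open>Q\<close>.\<close>
  have False if S: "S \<in> \<F>" for S
  proof -
    have "finite S" "S \<subseteq> ?h ` carrier G"
      using persistentD(1,2)[OF quotient.prems S] surj by auto
    from finite_subset_image[OF this]
    obtain T where "T \<subseteq> carrier G" "finite T" "S = ?h ` T" by blast
    then have "T \<in> {S. finite S \<and> S \<subseteq> carrier G \<and> ?h ` S \<in> \<F>}" using S by blast
    then show False
      using quotient.IH[OF group_hom.persistent_vimage[OF hom quotient.prems]] by blast
  qed
  then show ?case by blast
qed


section \<open>Closure properties and completeness of certificates\<close>

lemma elementary_amenable_group: "elementary_amenable G \<Longrightarrow> group G"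
  by (simp add: elementary_amenable_def)

lemma elementary_amenable_persistent:
  assumes "elementary_amenable G" "persistent G \<F>"
  shows "\<F> = {}"
proof -
  obtain H where H: "elementary_amenable_nat H" "G \<cong> H" and G: "group G"
    using assms(1) by (auto simp: elementary_amenable_def)
  obtain h where h: "group_hom G H h" "inj_on h (carrier G)"
    using isoE_group_hom[OF G elementary_amenable_nat_group[OF H(1)] H(2)] by metis
  have "persistent H ((`) h ` \<F>)"
  proof (rule group_hom.persistent_image[OF h(1) assms(2)])
    fix S assume "S \<in> \<F>"
    then show "\<not> S \<subseteq> kernel G H h"
      using persistentD(3)[OF assms(2)] group_hom.inj_iff_trivial_ker[OF h(1)] h(2) by auto
  qed
  from elementary_amenable_nat_persistent[OF H(1) this] show ?thesis by blast
qed

lemma elementary_amenable_iso: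
  assumes "elementary_amenable G" "G \<cong> H" "group H"
  shows "elementary_amenable H"
  using assms group.iso_sym[OF elementary_amenable_group[OF assms(1)] assms(2)] iso_trans
  unfolding elementary_amenable_def by blast

lemma elementary_amenable_iff_nat:
  "elementary_amenable H \<longleftrightarrow> elementary_amenable_nat H"
proof
  assume "elementary_amenable H"
  then show "elementary_amenable_nat H"
    unfolding elementary_amenable_def
    by (meson elementary_amenable_nat.iso elementary_amenable_nat_group group.iso_sym)
next
  assume "elementary_amenable_nat H"
  then show "elementary_amenable H"
    unfolding elementary_amenable_def using elementary_amenable_nat_group iso_refl by blast
qed

lemma elementary_amenable_iso_iff:
  assumes "group G" "group H" "G \<cong> H"
  shows "elementary_amenable G \<longleftrightarrow> elementary_amenable H"
  using elementary_amenable_iso[OF _ assms(3,2)]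
    elementary_amenable_iso[OF _ group.iso_sym[OF assms(1,3)] assms(1)] by (rule iffI)

text \<open>Transport of structure along an enumeration of the carrier. It makes the closure rules,
  which are stated for groups on \<open>nat\<close>, available for countable groups on any
  type.\<close>

lemma (in group) countable_group_iso_nat:
  assumes "countable (carrier G)"
  obtains H :: "nat monoid" and h where "group H" "h \<in> iso G H"
proof -
  define f where "f = to_nat_on (carrier G)"
  have f: "inj_on f (carrier G)" unfolding f_def by (rule inj_on_to_nat_on) fact
  define H where "H = \<lparr>carrier = f ` carrier G,
    mult = (\<lambda>x y. f (inv_into (carrier G) f x \<otimes> inv_into (carrier G) f y)), one = f \<one>\<rparr>"
  have iso: "f \<in> iso G H"
    using f by (auto simp: iso_def hom_def bij_betw_def H_def)
  then have "group (H\<lparr>one := f \<one>\<rparr>)" by (rule iso_imp_img_group)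
  then have "group H" by (simp add: H_def)
  with iso show ?thesis by (rule that[rotated])
qed

lemma iso_subgroup_restrict:
  assumes "h \<in> iso G H" "group G" "group H" "subgroup K G"
  shows "G\<lparr>carrier := K\<rparr> \<cong> H\<lparr>carrier := h ` K\<rparr>"
  using iso_restrict[OF assms] by (rule is_isoI)

lemma elementary_amenable_subgroup:
  assumes G: "elementary_amenable G" and K: "subgroup K G"
  shows "elementary_amenable (G\<lparr>carrier := K\<rparr>)"
proof -
  note gG = elementary_amenable_group[OF G]
  obtain H h where h: "elementary_amenable_nat H" "h \<in> iso G H"
    using G by (auto simp: elementary_amenable_def is_iso_def)
  note gH = elementary_amenable_nat_group[OF h(1)]
  have "subgroup (h ` K) H" by (rule subgroup.iso_subgroup[OF K gG gH h(2)])
  then have "elementary_amenable_nat (H\<lparr>carrier := h ` K\<rparr>)"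
    by (rule elementary_amenable_nat.subgroup[OF h(1)])
  then show ?thesis
    using iso_subgroup_restrict[OF h(2) gG gH K] group.subgroup_imp_group[OF gG K]
    by (auto simp: elementary_amenable_def)
qed

lemma elementary_amenable_finite:
  assumes "group G" "finite (carrier G)" shows "elementary_amenable G"
proof -
  obtain H :: "nat monoid" and h where H: "group H" "h \<in> iso G H"
    using group.countable_group_iso_nat[OF assms(1) countable_finite[OF assms(2)]] .
  then have "finite (carrier H)"
    using assms(2) by (auto simp: iso_def bij_betw_finite)
  then show ?thesis
    using H assms(1) elementary_amenable_nat.finite is_isoI unfolding elementary_amenable_def by blast
qed

lemma elementary_amenable_abelian:
  assumes "comm_group G" "countable (carrier G)" shows "elementary_amenable G"
proof -
  interpret comm_group G by fact
  obtain H :: "nat monoid" and h where H: "group H" "h \<in> iso G H"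
    using group.countable_group_iso_nat[OF group_axioms assms(2)] .
  then have h: "h ` carrier G = carrier H" "h \<in> hom G H" by (auto simp: iso_def bij_betw_def)
  have "comm_group H"
  proof (rule group.group_comm_groupI[OF H(1)])
    fix x y assume "x \<in> carrier H" "y \<in> carrier H"
    then obtain a b where "a \<in> carrier G" "b \<in> carrier G" "x = h a" "y = h b"
      unfolding h(1)[symmetric] by blast
    then show "x \<otimes>\<^bsub>H\<^esub> y = y \<otimes>\<^bsub>H\<^esub> x"
      using hom_mult[OF h(2)] m_comm by metis
  qed
  then show ?thesis
    using H(2) is_group elementary_amenable_nat.abelian is_isoI unfolding elementary_amenable_def by blast
qed

text \<open>Closure under extensions in the form used below. The image of \<open>h\<close> is
  elementary amenable as a subgroup of \<open>H\<close> and is isomorphic to the quotient by the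
  kernel, so the extension rule applies after transport to \<open>nat\<close>.\<close>

lemma elementary_amenable_hom:
  assumes h: "group_hom G H h" and c: "countable (carrier G)"
    and H: "elementary_amenable H" and K: "elementary_amenable (G\<lparr>carrier := kernel G H h\<rparr>)"
  shows "elementary_amenable G"
proof -
  interpret h: group_hom G H h by fact
  obtain G0 :: "nat monoid" and f where G0: "group G0" "f \<in> iso G0 G"
    using group.countable_group_iso_nat[OF h.G.group_axioms c] h.G.iso_set_sym by metis
  interpret G0: group G0 by fact
  have f: "f \<in> hom G0 G" "f ` carrier G0 = carrier G" "inj_on f (carrier G0)"
    using G0(2) by (auto simp: iso_def bij_betw_def)
  interpret g: group_hom G0 H "h \<circ> f"
    by unfold_locales (rule Group.hom_compose[OF f(1) h.homh])
  let ?I = "(h \<circ> f) ` carrier G0" and ?N = "kernel G0 H (h \<circ> f)"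
  have I: "subgroup ?I H" by (rule g.img_is_subgroup)
  have "elementary_amenable (H\<lparr>carrier := ?I\<rparr>)"
    by (rule elementary_amenable_subgroup[OF H I])
  then obtain Q where Q: "elementary_amenable_nat Q" "H\<lparr>carrier := ?I\<rparr> \<cong> Q"
    by (auto simp: elementary_amenable_def)
  interpret g': group_hom G0 "H\<lparr>carrier := ?I\<rparr>" "h \<circ> f"
    using g.induced_group_hom[OF G0.subgroup_self] by simp
  have "G0 Mod ?N \<cong> H\<lparr>carrier := ?I\<rparr>"
    using g'.FactGroup_iso by (simp add: kernel_def)
  then have GQ: "G0 Mod ?N \<cong> Q" using Q(2) by (rule iso_trans)
  have "f ` ?N = kernel G H h"
    using f(2) by (auto simp: kernel_def image_iff)
  then have "G0\<lparr>carrier := ?N\<rparr> \<cong> G\<lparr>carrier := kernel G H h\<rparr>"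
    using iso_subgroup_restrict[OF G0(2,1) h.G.group_axioms g.subgroup_kernel] by simp
  then have "elementary_amenable (G0\<lparr>carrier := ?N\<rparr>)"
    using K elementary_amenable_iso_iff[OF G0.subgroup_imp_group[OF g.subgroup_kernel]]
      elementary_amenable_group by blast
  then have "elementary_amenable_nat G0"
    using elementary_amenable_nat.extension[OF g.normal_kernel _ Q(1) GQ]
    by (simp add: elementary_amenable_iff_nat)
  then show ?thesis
    using elementary_amenable_iff_nat elementary_amenable_iso G0(2) is_isoI h.G.group_axioms by blast
qed

lemma elementary_amenable_incseq:
  fixes K :: "nat \<Rightarrow> 'a set"
  assumes G: "group G" and c: "countable (carrier G)" and K: "\<And>n. subgroup (K n) G" "incseq K"
    and U: "carrier G = (\<Union>n. K n)" and EA: "\<And>n. elementary_amenable (G\<lparr>carrier := K n\<rparr>)"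
  shows "elementary_amenable G"
proof -
  obtain H :: "nat monoid" and h where H: "group H" "h \<in> iso G H"
    using group.countable_group_iso_nat[OF G c] .
  have sub: "subgroup (h ` K n) H" for n
    by (rule subgroup.iso_subgroup[OF K(1) G H])
  have "elementary_amenable_nat H"
  proof (rule elementary_amenable_nat.increasing_union[OF H(1), of "\<lambda>n. h ` K n"])
    show "incseq (\<lambda>n. h ` K n)" using K(2) by (auto simp: incseq_def image_mono)
    show "carrier H = (\<Union>n. h ` K n)"
      using H(2) U by (auto simp: iso_def bij_betw_def simp flip: image_UN)
    show "elementary_amenable_nat (H\<lparr>carrier := h ` K n\<rparr>)" for n
      using elementary_amenable_iso[OF EA iso_subgroup_restrict[OF H(2) G H(1) K(1)]
          group.subgroup_imp_group[OF H(1) sub]]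
      by (simp add: elementary_amenable_iff_nat)
  qed (rule sub)
  then show ?thesis
    using G H(2) is_isoI unfolding elementary_amenable_def by blast
qed

text \<open>The quotient by \<open>M\<close> is abelian because commutators lie in \<open>M\<close>,
  or finite because it is covered by the cosets of \<open>C\<close>. Either way the quotient map
  exhibits \<open>G\<close> as an extension.\<close>

lemma (in group) elementary_amenable_fin_ab_normal:
  assumes c: "countable (carrier G)" and M: "fin_ab_normal G (carrier G) M"
    and EA: "elementary_amenable (G\<lparr>carrier := M\<rparr>)"
  shows "elementary_amenable G"
proof -
  have subM: "subgroup M G" using fin_ab_normalD(1)[OF M] .
  have "M \<lhd> G"
    unfolding normal_inv_iff using fin_ab_normalD[OF M] by blast
  then interpret normal M G .
  interpret q: group_hom G "G Mod M" "\<lambda>a. M #> a"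
    by (intro group_hom.intro group_hom_axioms.intro r_coset_hom_Mod factorgroup_is_group is_group)
  have ker: "kernel G (G Mod M) (\<lambda>a. M #> a) = M"
    using rcos_self[OF _ subM] coset_join2[OF _ subM] subset
    by (auto simp: kernel_def FactGroup_def)
  have eq: "M #> x = M #> y" if "x \<otimes> inv y \<in> M" "x \<in> carrier G" "y \<in> carrier G" for x y
    by (rule coset_mult_inv1) (use that subset coset_join2[OF _ subM] in auto)
  have carr: "carrier (G Mod M) = (\<lambda>a. M #> a) ` carrier G"
    by (auto simp: FactGroup_def RCOSETS_def)
  have "elementary_amenable (G Mod M)"
    using M
  proof (cases rule: fin_ab_normalE)
    case abelian
    have "comm_group (G Mod M)"
    proof (rule group.group_comm_groupI[OF factorgroup_is_group])
      fix X Y assume "X \<in> carrier (G Mod M)" "Y \<in> carrier (G Mod M)"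
      then obtain x y where xy: "x \<in> carrier G" "y \<in> carrier G" "X = M #> x" "Y = M #> y"
        unfolding carr by blast
      have "(x \<otimes> y) \<otimes> inv (y \<otimes> x) = x \<otimes> y \<otimes> inv x \<otimes> inv y"
        using xy by (simp add: inv_mult_group m_assoc)
      then have "(x \<otimes> y) \<otimes> inv (y \<otimes> x) \<in> M" using abelian[OF xy(1,2)] by (simp only:)
      then have "M #> (x \<otimes> y) = M #> (y \<otimes> x)"
        by (rule eq) (simp_all add: xy(1,2))
      moreover have "X \<otimes>\<^bsub>G Mod M\<^esub> Y = M #> (x \<otimes> y)" "Y \<otimes>\<^bsub>G Mod M\<^esub> X = M #> (y \<otimes> x)"
        using rcos_sum[OF xy(1,2)] rcos_sum[OF xy(2,1)] by (simp_all add: xy(3,4) FactGroup_def)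
      ultimately show "X \<otimes>\<^bsub>G Mod M\<^esub> Y = Y \<otimes>\<^bsub>G Mod M\<^esub> X" by (simp only:)
    qed
    moreover have "countable (carrier (G Mod M))" unfolding carr using c by simp
    ultimately show ?thesis by (rule elementary_amenable_abelian)
  next
    case (finite C)
    have "carrier (G Mod M) \<subseteq> (\<lambda>a. M #> a) ` C"
      proof
      fix X assume "X \<in> carrier (G Mod M)"
      then obtain x where x: "x \<in> carrier G" "X = M #> x" unfolding carr by blast
      then obtain c where "c \<in> C" "x \<otimes> inv c \<in> M" using finite(3) by blast
      then show "X \<in> (\<lambda>a. M #> a) ` C" using eq x finite(2) by blast
    qed
    then have "finite (carrier (G Mod M))" using finite(1) finite_surj by blast
    then show ?thesis by (rule elementary_amenable_finite[OF factorgroup_is_group])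
  qed
  then show ?thesis
    using elementary_amenable_hom[OF q.group_hom_axioms c] ker EA by simp
qed

text \<open>An enumeration of the carrier writes \<open>G\<close> as the increasing union of the
  subgroups generated by initial segments of the enumeration.\<close>

lemma elementary_amenable_finitely_generated:
  assumes G: "group G" and c: "countable (carrier G)"
    and EA: "\<And>S. finite S \<Longrightarrow> S \<subseteq> carrier G \<Longrightarrow> elementary_amenable (G\<lparr>carrier := generate G S\<rparr>)"
  shows "elementary_amenable G"
proof -
  interpret group G by fact
  define S where "S n = from_nat_into (carrier G) ` {..n::nat}" for n
  have S: "finite (S n)" "S n \<subseteq> carrier G" for n
    using from_nat_into[of "carrier G"] by (auto simp: S_def)
  show ?thesis
  proof (rule elementary_amenable_incseq[OF G c, of "\<lambda>n. generate G (S n)"])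
    show "subgroup (generate G (S n)) G" for n by (rule generate_is_subgroup[OF S(2)])
    show "incseq (\<lambda>n. generate G (S n))"
      unfolding incseq_def by (auto intro!: mono_generate simp: S_def)
    have "x \<in> (\<Union>n. generate G (S n))" if "x \<in> carrier G" for x
    proof -
      obtain n where "x = from_nat_into (carrier G) n"
        using from_nat_into_surj[OF c \<open>x \<in> carrier G\<close>] by metis
      then have "x \<in> generate G (S n)" by (auto simp: S_def intro: generate.incl)
      then show ?thesis by blast
    qed
    then show "carrier G = (\<Union>n. generate G (S n))"
      using generate_incl[OF S(2)] by blast
    show "elementary_amenable (G\<lparr>carrier := generate G (S n)\<rparr>)" for n
      by (rule EA[OF S])
  qed
qed

text \<open>If a test kernel \<open>M\<close> were elementary amenable, its extension by a finite or
  abelian quotient would be too. Hence \<open>M\<close> is not, and so some finite subset of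
  \<open>M\<close> already generates a group that is not elementary amenable.\<close>

lemma persistent_not_elementary_amenable:
  assumes G: "group G" and c: "countable (carrier G)"
  shows "persistent G {S. finite S \<and> S \<subseteq> carrier G \<and>
    \<not> elementary_amenable (G\<lparr>carrier := generate G S\<rparr>)}" (is "persistent G ?F")
  unfolding persistent_def
proof (intro ballI conjI allI impI)
  interpret group G by fact
  fix S assume "S \<in> ?F"
  then have S: "finite S" "S \<subseteq> carrier G" "\<not> elementary_amenable (G\<lparr>carrier := generate G S\<rparr>)"
    by auto
  show "finite S" "S \<subseteq> carrier G" by fact+
  note gen = generate_is_subgroup[OF S(2)]
  note gengrp = subgroup_imp_group[OF gen]
  show "\<not> S \<subseteq> {\<one>\<^bsub>G\<^esub>}"
  proof
    assume "S \<subseteq> {\<one>\<^bsub>G\<^esub>}"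
    then have "generate G S \<subseteq> {\<one>\<^bsub>G\<^esub>}" by (rule generate_subgroup_incl) (rule triv_subgroup)
    then have "finite (generate G S)" by (rule finite_subset) simp
    then show False using S(3) elementary_amenable_finite[OF gengrp] by simp
  qed
  fix M assume M: "fin_ab_normal G (generate G S) M"
  have subM: "subgroup M G" and MsubL: "M \<subseteq> generate G S"
    using fin_ab_normalD[OF M] by simp_all
  have cnt: "countable X" if "X \<subseteq> carrier G" for X using c that countable_subset by blast
  have M': "fin_ab_normal (G\<lparr>carrier := generate G S\<rparr>) (carrier (G\<lparr>carrier := generate G S\<rparr>)) M"
    using fin_ab_normal_restrict_iff[OF gen subset_refl, THEN iffD2, OF M] by simp
  have "\<not> elementary_amenable (G\<lparr>carrier := M\<rparr>)"
    using group.elementary_amenable_fin_ab_normal[OF gengrp _ M'] S(3) cnt generate_incl[OF S(2)]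
    by auto
  then obtain T where T: "finite T" "T \<subseteq> M"
      "\<not> elementary_amenable (G\<lparr>carrier := generate (G\<lparr>carrier := M\<rparr>) T\<rparr>)"
    using elementary_amenable_finitely_generated[OF subgroup_imp_group[OF subM]]
      cnt[OF subgroup.subset[OF subM]] by auto
  moreover have "generate (G\<lparr>carrier := M\<rparr>) T = generate G T"
    by (rule generate_consistent[OF T(2) subM])
  ultimately show "\<exists>S'\<in>?F. S' \<subseteq> M"
    using subgroup.subset[OF subM] by (intro bexI[of _ T]) auto
qed

text \<open>Persistence is a condition on \<open>\<F>\<close> inside \<open>F\<close> alone; the normal subgroup \<open>N\<close> enters only through
  \<open>\<not> S \<subseteq> N\<close>. This is what makes the complement of \<open>EG\<close> analytic.\<close>

theorem not_elementary_amenable_Mod_iff: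
  assumes N: "N \<lhd> F" and c: "countable (carrier F)"
  shows "\<not> elementary_amenable (F Mod N) \<longleftrightarrow>
    (\<exists>\<F>. \<F> \<noteq> {} \<and> persistent F \<F> \<and> (\<forall>S\<in>\<F>. \<not> S \<subseteq> N))"
proof -
  interpret normal N F by fact
  interpret q: group_hom F "F Mod N" "\<lambda>a. N #>\<^bsub>F\<^esub> a"
    by (intro group_hom.intro group_hom_axioms.intro r_coset_hom_Mod factorgroup_is_group is_group)
  have ker: "kernel F (F Mod N) (\<lambda>a. N #>\<^bsub>F\<^esub> a) = N"
    using rcos_self[OF _ is_subgroup] coset_join2[OF _ is_subgroup] subset
    by (auto simp: kernel_def FactGroup_def)
  have carr: "carrier (F Mod N) = (\<lambda>a. N #>\<^bsub>F\<^esub> a) ` carrier F"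
    by (auto simp: FactGroup_def RCOSETS_def)
  show ?thesis
  proof
    assume nEA: "\<not> elementary_amenable (F Mod N)"
    define \<F> where "\<F> = {S. finite S \<and> S \<subseteq> carrier (F Mod N) \<and>
      \<not> elementary_amenable ((F Mod N)\<lparr>carrier := generate (F Mod N) S\<rparr>)}"
    \<comment> \<open>All finite lifts to \<open>F\<close> of the canonical family of the quotient.
      No lift lies in \<open>N\<close>, because members downstairs are nontrivial.\<close>
    define \<F>' where "\<F>' = {S. finite S \<and> S \<subseteq> carrier F \<and> (\<lambda>a. N #>\<^bsub>F\<^esub> a) ` S \<in> \<F>}"
    have cq: "countable (carrier (F Mod N))" unfolding carr using c by simp
    have P: "persistent (F Mod N) \<F>"
      unfolding \<F>_def by (rule persistent_not_elementary_amenable[OF factorgroup_is_group cq])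
    have "\<F> \<noteq> {}"
      using elementary_amenable_finitely_generated[OF factorgroup_is_group cq] nEA
      unfolding \<F>_def by blast
    then obtain S where S: "S \<in> \<F>" by blast
    then have "finite S" "S \<subseteq> (\<lambda>a. N #>\<^bsub>F\<^esub> a) ` carrier F" using carr by (auto simp: \<F>_def)
    from finite_subset_image[OF this] have "\<F>' \<noteq> {}"
      using S unfolding \<F>'_def by blast
    moreover have "persistent F \<F>'" unfolding \<F>'_def by (rule q.persistent_vimage[OF P])
    moreover have "\<not> T \<subseteq> N" if T: "T \<in> \<F>'" for T
    proof
      assume "T \<subseteq> N"
      then have "(\<lambda>a. N #>\<^bsub>F\<^esub> a) ` T \<subseteq> {\<one>\<^bsub>F Mod N\<^esub>}"
        using ker unfolding kernel_def by blast
      moreover have "(\<lambda>a. N #>\<^bsub>F\<^esub> a) ` T \<in> \<F>" using T by (simp add: \<F>'_def)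
      ultimately show False using persistentD(3)[OF P] by blast
    qed
    ultimately show "\<exists>\<F>. \<F> \<noteq> {} \<and> persistent F \<F> \<and> (\<forall>S\<in>\<F>. \<not> S \<subseteq> N)" by blast
  next
    assume "\<exists>\<F>. \<F> \<noteq> {} \<and> persistent F \<F> \<and> (\<forall>S\<in>\<F>. \<not> S \<subseteq> N)"
    then obtain \<F> where F: "\<F> \<noteq> {}" "persistent F \<F>" "\<forall>S\<in>\<F>. \<not> S \<subseteq> N" by blast
    have "persistent (F Mod N) ((`) (\<lambda>a. N #>\<^bsub>F\<^esub> a) ` \<F>)"
      by (rule q.persistent_image[OF F(2)]) (use F(3) ker in blast)
    then show "\<not> elementary_amenable (F Mod N)"
      using elementary_amenable_persistent F(1) by blast
  qed
qed

text \<open>Schreier's argument: the elements \<open>c \<otimes> s \<otimes> inv d\<close> of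
  \<open>M\<close>, with representatives \<open>c\<close>, \<open>d\<close> and a generator or
  inverse generator \<open>s\<close>, together with the representatives in \<open>M\<close>,
  generate \<open>M\<close>.\<close>

lemma (in group) finite_index_finitely_generated:
  assumes S: "finite S" "S \<subseteq> carrier G" and M: "subgroup M G" "M \<subseteq> generate G S"
    and C: "finite C" "C \<subseteq> generate G S" "\<And>x. x \<in> generate G S \<Longrightarrow> \<exists>c\<in>C. x \<otimes> inv c \<in> M"
  obtains T where "finite T" "M = generate G T"
proof -
  \<comment> \<open>The identity is added so that the set \<open>U\<close> below contains
    it.\<close>
  define D where "D = insert \<one> C"
  define R where "R = S \<union> (\<lambda>x. inv x) ` S"
  \<comment> \<open>\<open>C\<close> may represent the coset \<open>M\<close> by an element other
    than the identity, so representatives lying in \<open>M\<close> are put into \<open>T\<close> as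
    well; the last step below uses this.\<close>
  define T where "T = (D \<union> (\<lambda>(c, s, d). c \<otimes> s \<otimes> inv d) ` (D \<times> R \<times> D)) \<inter> M"
  have fin: "finite T" unfolding T_def D_def R_def using C(1) S(1) by blast
  have TM: "T \<subseteq> M" by (simp add: T_def)
  have Mc: "M \<subseteq> carrier G" by (rule subgroup.subset[OF M(1)])
  have Dc: "D \<subseteq> carrier G" using C(2) generate_incl[OF S(2)] by (auto simp: D_def)
  have DL: "D \<subseteq> generate G S" using C(2) by (auto simp: D_def intro: generate.one)
  have RL: "R \<subseteq> generate G S" by (auto simp: R_def intro: generate.incl generate.inv)
  have Rc: "R \<subseteq> carrier G" using RL generate_incl[OF S(2)] by blast
  note T = generate_is_subgroup[OF order_trans[OF TM Mc]]
  have Tc: "generate G T \<subseteq> carrier G" by (rule subgroup.subset[OF T])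
  \<comment> \<open>This union of cosets of the subgroup generated by \<open>T\<close> is closed
    under right multiplication by generators. As it contains the identity, it contains everything
    generated by \<open>S\<close>.\<close>
  define U where "U = {m \<otimes> c | m c. m \<in> generate G T \<and> c \<in> D}"
  have UR: "u \<otimes> r \<in> U" if ur: "u \<in> U" "r \<in> R" for u r
  proof -
    obtain m c where mc: "m \<in> generate G T" "c \<in> D" "u = m \<otimes> c" using ur(1) by (auto simp: U_def)
    have "c \<otimes> r \<in> generate G S" using mc(2) ur(2) DL RL by (blast intro: generate.eng)
    then obtain d where d: "d \<in> C" "c \<otimes> r \<otimes> inv d \<in> M" using C(3) by blast
    have dD: "d \<in> D" using d by (simp add: D_def)
    have "c \<otimes> r \<otimes> inv d \<in> T"
      unfolding T_def using d(2) mc(2) ur(2) dD by (auto intro!: image_eqI[of _ _ "(c, r, d)"])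
    then have t: "m \<otimes> (c \<otimes> r \<otimes> inv d) \<in> generate G T"
      using mc(1) by (blast intro: generate.intros)
    have [simp]: "m \<in> carrier G" "c \<in> carrier G" "r \<in> carrier G" "d \<in> carrier G"
      using mc ur dD Dc Rc Tc by auto
    have "u \<otimes> r = m \<otimes> (c \<otimes> r \<otimes> inv d) \<otimes> d" by (simp add: mc(3) m_assoc)
    with t dD show ?thesis unfolding U_def by blast
  qed
  have Uc: "U \<subseteq> carrier G" using Tc Dc by (auto simp: U_def)
  have US: "u \<otimes> x \<in> U" if "x \<in> generate G S" "u \<in> U" for u x
    using that
  proof (induction x arbitrary: u rule: generate.induct)
    case one then show ?case using Uc by auto
  next
    case (incl h) then show ?case using UR[of u h] by (simp add: R_def)
  next
    case (inv h) then show ?case using UR[of u "inv h"] by (simp add: R_def)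
  next
    case (eng h1 h2)
    have "h1 \<in> carrier G" "h2 \<in> carrier G" using eng.hyps generate_incl[OF S(2)] by auto
    then have "u \<otimes> (h1 \<otimes> h2) = (u \<otimes> h1) \<otimes> h2" using eng.prems Uc by (auto simp: m_assoc)
    then show ?case using eng by simp
  qed
  have "\<one> \<in> U" unfolding U_def D_def using generate.one[of G T] by force
  have "M \<subseteq> generate G T"
  proof
    fix x assume x: "x \<in> M"
    then have xc: "x \<in> carrier G" using Mc by auto
    have "\<one> \<otimes> x \<in> U" using US[OF _ \<open>\<one> \<in> U\<close>] x M(2) by blast
    then obtain m c where mc: "m \<in> generate G T" "c \<in> D" "x = m \<otimes> c"
      using xc by (auto simp: U_def)
    have mM: "m \<in> M" using mc(1) generate_subgroup_incl[OF TM M(1)] by blast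
    have "c \<in> carrier G" "m \<in> carrier G" using mc Dc Tc by auto
    then have "c = inv m \<otimes> x" by (simp add: mc(3) m_assoc[symmetric])
    then have "c \<in> M" using mM x M(1) by (simp add: subgroup.m_closed subgroup.m_inv_closed)
    then have "c \<in> T" using mc(2) by (simp add: T_def)
    then show "x \<in> generate G T" using mc by (blast intro: generate.intros)
  qed
  moreover have "generate G T \<subseteq> M" by (rule generate_subgroup_incl[OF TM M(1)])
  ultimately show ?thesis using that fin by blast
qed

text \<open>The derived subgroup lies in every kernel with abelian quotient. Testing it alone
  therefore replaces testing all those kernels, which may fail to be finitely generated.\<close>

lemma (in group) fin_ab_normal_derived:
  assumes "subgroup L G"
  shows "fin_ab_normal G L (derived G L)"
proof (rule fin_ab_normalI)
  have Lc: "L \<subseteq> carrier G" by (rule subgroup.subset[OF assms])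
  have comm: "x \<otimes> y \<otimes> inv x \<otimes> inv y \<in> derived G L" if "x \<in> L" "y \<in> L" for x y
    unfolding derived_def using that by (intro generate.incl) blast
  show "subgroup (derived G L) G" by (rule derived_is_subgroup[OF Lc])
  show le: "derived G L \<subseteq> L" by (rule derived_incl[OF subset_refl assms])
  show "x \<otimes> m \<otimes> inv x \<in> derived G L" if "x \<in> L" "m \<in> derived G L" for x m
  proof -
    have "m \<in> L" using that le by blast
    then have "x \<in> carrier G" "m \<in> carrier G" using that Lc by auto
    then have eq: "(x \<otimes> m \<otimes> inv x \<otimes> inv m) \<otimes> m = x \<otimes> m \<otimes> inv x" by (simp add: m_assoc)
    have "(x \<otimes> m \<otimes> inv x \<otimes> inv m) \<otimes> m \<in> derived G L"
      using comm[OF that(1) \<open>m \<in> L\<close>] that(2) unfolding derived_def by (rule generate.eng)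
    then show ?thesis unfolding eq .
  qed
  show "(\<forall>x\<in>L. \<forall>y\<in>L. x \<otimes> y \<otimes> inv x \<otimes> inv y \<in> derived G L) \<or>
      (\<exists>C. finite C \<and> C \<subseteq> L \<and> (\<forall>x\<in>L. \<exists>c\<in>C. x \<otimes> inv c \<in> derived G L))"
    using comm by blast
qed

text \<open>Only countably many subgroups \<open>M\<close> are tested on the right-hand side if \<open>G\<close> is countable.\<close>

lemma (in group) persistent_iff_finitely_generated:
  "persistent G \<F> \<longleftrightarrow> (\<forall>S\<in>\<F>. finite S \<and> S \<subseteq> carrier G \<and> \<not> S \<subseteq> {\<one>} \<and>
     (\<exists>S'\<in>\<F>. S' \<subseteq> derived G (generate G S)) \<and>
     (\<forall>T. finite T \<longrightarrow> fin_ab_normal G (generate G S) (generate G T) \<longrightarrow>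
        (\<exists>S'\<in>\<F>. S' \<subseteq> generate G T)))" (is "_ = ?R")
proof
  assume P: "persistent G \<F>"
  show ?R
  proof (intro ballI conjI allI impI)
    fix S assume "S \<in> \<F>"
    note S = persistentD[OF P this]
    show "finite S" "S \<subseteq> carrier G" "\<not> S \<subseteq> {\<one>}" by (fact S)+
    show "\<exists>S'\<in>\<F>. S' \<subseteq> derived G (generate G S)"
      by (rule S(4)[OF fin_ab_normal_derived[OF generate_is_subgroup[OF S(2)]]])
    show "\<exists>S'\<in>\<F>. S' \<subseteq> generate G T"
      if "fin_ab_normal G (generate G S) (generate G T)" for T
      by (rule S(4)[OF that])
  qed
next
  assume R: ?R
  show "persistent G \<F>"
    unfolding persistent_def
  proof (intro ballI conjI allI impI)
    fix S assume S: "S \<in> \<F>"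
    note R = bspec[OF R S]
    show S': "finite S" "S \<subseteq> carrier G" "\<not> S \<subseteq> {\<one>}"
      using R[THEN conjunct1] R[THEN conjunct2, THEN conjunct1]
        R[THEN conjunct2, THEN conjunct2, THEN conjunct1] by this
    obtain D where D: "D \<in> \<F>" "D \<subseteq> derived G (generate G S)"
      using R[THEN conjunct2, THEN conjunct2, THEN conjunct2, THEN conjunct1] by (rule bexE)
    fix M assume M: "fin_ab_normal G (generate G S) M"
    then show "\<exists>S'\<in>\<F>. S' \<subseteq> M"
    proof (cases rule: fin_ab_normalE)
      case abelian
      then have "derived_set G (generate G S) \<subseteq> M" by blast
      then have "derived G (generate G S) \<subseteq> M"
        unfolding derived_def by (rule generate_subgroup_incl) (rule fin_ab_normalD(1)[OF M])
      then show ?thesis using D by blast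
    next
      \<comment> \<open>A kernel of finite index in a finitely generated group is finitely
        generated, so it occurs among the subgroups tested on the right-hand side.\<close>
      case (finite C)
      obtain T where T: "Finite_Set.finite T" "M = generate G T"
        using finite_index_finitely_generated[OF S'(1,2) fin_ab_normalD(1,2)[OF M] finite] by metis
      show ?thesis using R[THEN conjunct2, THEN conjunct2, THEN conjunct2, THEN conjunct2] T(1) M
        unfolding T(2) by simp
    qed
  qed
qed


section \<open>Analyticity of the complement\<close>

lemma sets_borel_of: "sets (borel_of T) = sigma_sets (topspace T) {U. openin T U}"
  unfolding borel_of_def by (rule sets_measure_of) (auto dest: openin_subset)

lemma standard_borel_nat_fun: "standard_borel (borel :: (nat \<Rightarrow> nat) measure)"
proof -
  let ?T = "euclidean :: (nat \<Rightarrow> nat) topology"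
  have "discrete_topology UNIV = (euclidean :: nat topology)"
    by (simp add: discrete_topology_unique open_discrete)
  then have "completely_metrizable_space (euclidean :: nat topology)"
    by (metis completely_metrizable_space_discrete_topology)
  then have "completely_metrizable_space ?T"
    unfolding euclidean_product_topology[symmetric] completely_metrizable_space_product_topology by simp
  moreover have "second_countable ?T"
  proof -
    obtain B :: "(nat \<Rightarrow> nat) set set" where "countable B" "topological_basis B"
      using ex_countable_basis by blast
    then show ?thesis
      unfolding second_countable_def
      by (metis open_openin topological_basisE topological_basis_open)
  qed
  moreover have "borel = borel_of ?T" by (simp add: borel_of_def borel_def)
  ultimately show ?thesis unfolding standard_borel_def by metis
qed

lemma uncountable_nat_fun: "uncountable (UNIV :: (nat \<Rightarrow> nat) set)"
proof
  assume c: "countable (UNIV :: (nat \<Rightarrow> nat) set)"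
  define f where "f n = Suc (from_nat_into (UNIV :: (nat \<Rightarrow> nat) set) n n)" for n
  obtain m where "from_nat_into UNIV m = f" using from_nat_into_surj[OF c] by blast
  then show False using f_def[of m] by simp
qed

lemma analytic_in_borelI:
  assumes "B \<in> sets ((borel :: (nat \<Rightarrow> nat) measure) \<Otimes>\<^sub>M Y)" "A = snd ` B"
  shows "analytic_in Y A"
  unfolding analytic_in_def using assms standard_borel_nat_fun uncountable_nat_fun
  by (intro exI[of _ borel] exI[of _ B]) simp

lemma analytic_in_restrict_space:
  assumes "analytic_in Y A"
  shows "analytic_in (restrict_space Y Z) (A \<inter> Z)"
proof -
  obtain X :: "(nat \<Rightarrow> nat) measure" and B where X: "standard_borel X" "uncountable (space X)"
    "B \<in> sets (X \<Otimes>\<^sub>M Y)" "A = snd ` B"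
    using assms unfolding analytic_in_def by blast
  have m: "(\<lambda>p. (fst p, snd p)) \<in> X \<Otimes>\<^sub>M restrict_space Y Z \<rightarrow>\<^sub>M X \<Otimes>\<^sub>M Y"
    by (intro measurable_Pair measurable_fst measurable_compose[OF measurable_snd]
        measurable_restrict_space1 measurable_ident_sets refl)
  have "B \<subseteq> space X \<times> space Y" using sets.sets_into_space[OF X(3)] by (simp add: space_pair_measure)
  then have "A \<inter> Z = snd ` (B \<inter> (space X \<times> (Z \<inter> space Y)))" using X(4) by force
  moreover have "B \<inter> (space X \<times> (Z \<inter> space Y)) \<in> sets (X \<Otimes>\<^sub>M restrict_space Y Z)"
    using measurable_sets[OF m X(3)] by (simp add: space_pair_measure space_restrict_space)
  ultimately show ?thesis unfolding analytic_in_def using X(1,2) by blast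
qed

lemma analytic_in_Un_sets:
  assumes "analytic_in Y A" "C \<in> sets Y"
  shows "analytic_in Y (A \<union> C)"
proof -
  obtain X :: "(nat \<Rightarrow> nat) measure" and B where X: "standard_borel X" "uncountable (space X)"
    "B \<in> sets (X \<Otimes>\<^sub>M Y)" "A = snd ` B"
    using assms(1) unfolding analytic_in_def by blast
  have "B \<union> space X \<times> C \<in> sets (X \<Otimes>\<^sub>M Y)" using X(3) assms(2) by auto
  moreover have "space X \<noteq> {}" using X(2) by auto
  then have "A \<union> C = snd ` (B \<union> space X \<times> C)" using X(4) by (simp add: image_Un snd_image_times)
  ultimately show ?thesis unfolding analytic_in_def using X(1,2) by blast
qed

section \<open>Borel structure of the space of marked groups\<close>

lemma openin_marked_groups_topology_mem:
  "openin marked_groups_topology {N \<in> marked_groups. w \<in> N}"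
proof (cases "w \<in> carrier free_group")
  case True
  let ?P = "product_topology (\<lambda>_. discrete_topology (UNIV :: bool set)) (carrier free_group)"
  have "openin ?P {f \<in> topspace ?P. f w \<in> {True}}"
    using True by (intro openin_continuous_map_preimage[OF continuous_map_product_projection]) auto
  then have "openin (powerset_topology (carrier free_group))
     ((\<lambda>A. \<lambda>x\<in>carrier free_group. x \<in> A) -` {f \<in> topspace ?P. f w \<in> {True}} \<inter> Pow (carrier free_group))"
    unfolding powerset_topology_def openin_pullback_topology by blast
  moreover have "{N \<in> marked_groups. w \<in> N} =
     ((\<lambda>A. \<lambda>x\<in>carrier free_group. x \<in> A) -` {f \<in> topspace ?P. f w \<in> {True}} \<inter> Pow (carrier free_group)) \<inter> marked_groups"
    using True by (auto simp: marked_groups_def dest: normal_imp_subgroup subgroup.subset)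
  ultimately show ?thesis
    unfolding marked_groups_topology_def openin_subtopology by blast
next
  case False
  then have empty: "{N \<in> marked_groups. w \<in> N} = {}"
    by (auto simp: marked_groups_def dest: normal_imp_subgroup subgroup.subset)
  show ?thesis unfolding empty by (rule openin_empty)
qed

lemma sets_marked_groups_mem: "{N \<in> marked_groups. w \<in> N} \<in> sets marked_groups_borel"
  unfolding marked_groups_borel_def sets_borel_of
  using openin_marked_groups_topology_mem by (intro sigma_sets.Basic) simp

lemma pred_marked_groups_mem [measurable]:
  "Measurable.pred marked_groups_borel (\<lambda>N. w \<in> N)"
  unfolding pred_def space_marked_groups_borel by (rule sets_marked_groups_mem)

text \<open>A basic open box restricts only finitely many coordinates, and \<open>K\<close> is the
  set of these coordinates.\<close>

lemma openin_marked_groups_topology_finite: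
  assumes "openin marked_groups_topology U" "N \<in> U"
  obtains K where "finite K" "\<And>M. M \<in> marked_groups \<Longrightarrow> M \<inter> K = N \<inter> K \<Longrightarrow> M \<in> U"
proof -
  let ?F = "carrier free_group" and ?D = "discrete_topology (UNIV :: bool set)"
  let ?chi = "\<lambda>A. \<lambda>x\<in>?F. x \<in> A"
  obtain W where W: "openin (product_topology (\<lambda>_. ?D) ?F) W"
    "U = ?chi -` W \<inter> Pow ?F \<inter> marked_groups"
    using assms(1) unfolding marked_groups_topology_def openin_subtopology powerset_topology_def
      openin_pullback_topology by blast
  have "?chi N \<in> W" using W(2) assms(2) by blast
  then obtain V where V: "finite {i \<in> ?F. V i \<noteq> topspace ?D}" "?chi N \<in> Pi\<^sub>E ?F V" "Pi\<^sub>E ?F V \<subseteq> W"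
    using W(1) unfolding openin_product_topology_alt by meson
  show thesis
  proof (rule that[OF V(1)])
    fix M assume M: "M \<in> marked_groups"
      "M \<inter> {i \<in> ?F. V i \<noteq> topspace ?D} = N \<inter> {i \<in> ?F. V i \<noteq> topspace ?D}"
    have "(w \<in> M) \<in> V w" if w: "w \<in> ?F" for w
    proof (cases "V w = UNIV")
      case False
      then have "(w \<in> M) = (w \<in> N)" using M(2) w by auto
      moreover have "(w \<in> N) \<in> V w" using V(2) w by (auto simp: PiE_iff)
      ultimately show ?thesis by simp
    qed simp
    then have "?chi M \<in> Pi\<^sub>E ?F V" by auto
    moreover have "M \<subseteq> ?F"
      using M(1) by (auto simp: marked_groups_def dest: normal_imp_subgroup subgroup.subset)
    ultimately show "M \<in> U" using W(2) M(1) V(3) by blast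
  qed
qed

text \<open>There are only countably many words, so an open set is a countable union of sets that
  prescribe finitely many memberships.\<close>

lemma measurable_marked_groupsI:
  assumes f: "\<And>x. x \<in> space M \<Longrightarrow> f x \<in> marked_groups"
    and mem [measurable]: "\<And>w. Measurable.pred M (\<lambda>x. w \<in> f x)"
  shows "f \<in> M \<rightarrow>\<^sub>M marked_groups_borel"
  unfolding marked_groups_borel_def borel_of_def
proof (rule measurable_measure_of)
  show "{U. openin marked_groups_topology U} \<subseteq> Pow (topspace marked_groups_topology)"
    by (auto dest: openin_subset)
  show "f \<in> space M \<rightarrow> topspace marked_groups_topology"
    using f by (simp add: topspace_marked_groups_topology)
  fix U assume "U \<in> {U. openin marked_groups_topology U}"
  then have U: "openin marked_groups_topology U" by simp
  \<comment> \<open>\<open>K\<close> lists words required to be in \<open>N\<close> and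
    \<open>L\<close> words required to be outside. Pairs of lists form a countable type, so
    quantifying over them preserves measurability.\<close>
  let ?good = "\<lambda>K L. \<forall>N\<in>marked_groups. (\<forall>w\<in>set K. w \<in> N) \<and> (\<forall>w\<in>set L. w \<notin> N) \<longrightarrow> N \<in> U"
  have eq: "f -` U \<inter> space M = {x \<in> space M. \<exists>K L. ?good K L \<and>
      (\<forall>w\<in>set K. w \<in> f x) \<and> (\<forall>w\<in>set L. w \<notin> f x)}"
  proof (rule subset_antisym; rule subsetI)
    fix x assume x: "x \<in> f -` U \<inter> space M"
    then obtain K where K: "finite K" "\<And>M. M \<in> marked_groups \<Longrightarrow> M \<inter> K = f x \<inter> K \<Longrightarrow> M \<in> U"
      using openin_marked_groups_topology_finite[OF U, of "f x"] by blast
    obtain K1 K2 where "set K1 = K \<inter> f x" "set K2 = K - f x"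
      using K(1) by (metis finite_Diff finite_Int finite_list)
    then have "?good K1 K2 \<and> (\<forall>w\<in>set K1. w \<in> f x) \<and> (\<forall>w\<in>set K2. w \<notin> f x)"
      using K(2) by blast
    then show "x \<in> {x \<in> space M. \<exists>K L. ?good K L \<and>
      (\<forall>w\<in>set K. w \<in> f x) \<and> (\<forall>w\<in>set L. w \<notin> f x)}" using x by blast
  qed (use f in blast)
  have "Measurable.pred M (\<lambda>x. \<exists>K L. ?good K L \<and> (\<forall>w\<in>set K. w \<in> f x) \<and> (\<forall>w\<in>set L. w \<notin> f x))"
    by measurable
  then show "f -` U \<inter> space M \<in> sets M" unfolding eq pred_def .
qed

lemma EG_subset: "EG \<subseteq> marked_groups" by (auto simp: EG_def)

lemma fg_marked_groups_subset: "fg_marked_groups \<subseteq> marked_groups"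
  by (auto simp: fg_marked_groups_def)

lemma sets_fg_marked_groups: "fg_marked_groups \<in> sets marked_groups_borel"
proof -
  have "fg_marked_groups =
      {N \<in> space marked_groups_borel. \<exists>m. m \<ge> 1 \<and> (\<forall>i. i \<ge> m \<longrightarrow> gen i \<in> N)}"
    by (auto simp: fg_marked_groups_def space_marked_groups_borel)
  also have "\<dots> \<in> sets marked_groups_borel" by measurable
  finally show ?thesis .
qed

text \<open>The witness projected away is a certificate: a point \<open>y\<close> of Baire space
  codes the family \<open>fam y\<close> of those finite sets that have a listing whose code gets a
  nonzero value.\<close>

lemma analytic_not_EG: "analytic_in marked_groups_borel (marked_groups - EG)"
proof -
  interpret F: group free_group by (rule group_free_group)
  define fam where "fam y = {set l | l :: letter list list. y (to_nat l) \<noteq> 0}" for y :: "nat \<Rightarrow> nat"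
  \<comment> \<open>Persistence with lists in place of finite sets: each quantifier runs over a
    countable type and each atom involves one value of \<open>y\<close> or does not depend on
    \<open>y\<close>, so \<open>W\<close> is Borel.\<close>
  define W where "W y \<longleftrightarrow> (\<forall>l. y (to_nat l) \<noteq> 0 \<longrightarrow> set l \<subseteq> carrier free_group \<and> \<not> set l \<subseteq> {\<one>\<^bsub>free_group\<^esub>} \<and>
     (\<exists>l'. y (to_nat l') \<noteq> 0 \<and> set l' \<subseteq> derived free_group (generate free_group (set l))) \<and>
     (\<forall>t. fin_ab_normal free_group (generate free_group (set l)) (generate free_group (set t)) \<longrightarrow>
        (\<exists>l'. y (to_nat l') \<noteq> 0 \<and> set l' \<subseteq> generate free_group (set t))))" for y :: "nat \<Rightarrow> nat"
  have famI: "set l \<in> fam y" if "y (to_nat l) \<noteq> 0" for y l using that by (auto simp: fam_def)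
  have famE: "\<exists>l. S = set l \<and> y (to_nat l) \<noteq> 0" if "S \<in> fam y" for S y using that by (auto simp: fam_def)
  have W: "W y \<longleftrightarrow> persistent free_group (fam y)" for y
  proof -
    define Q where "Q S \<longleftrightarrow> S \<subseteq> carrier free_group \<and> \<not> S \<subseteq> {\<one>\<^bsub>free_group\<^esub>} \<and>
      (\<exists>S'\<in>fam y. S' \<subseteq> derived free_group (generate free_group S)) \<and>
      (\<forall>T. finite T \<longrightarrow> fin_ab_normal free_group (generate free_group S) (generate free_group T) \<longrightarrow>
        (\<exists>S'\<in>fam y. S' \<subseteq> generate free_group T))" for S
    have ex: "(\<exists>l'. y (to_nat l') \<noteq> 0 \<and> set l' \<subseteq> X) \<longleftrightarrow> (\<exists>S'\<in>fam y. S' \<subseteq> X)" for X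
      by (auto simp: fam_def)
    have all: "(\<forall>t. P (set t)) \<longleftrightarrow> (\<forall>T. finite T \<longrightarrow> P T)" for P :: "letter list set \<Rightarrow> bool"
      by (metis finite_list List.finite_set)
    have "finite S" if "S \<in> fam y" for S using famE[OF that] by auto
    then have "persistent free_group (fam y) \<longleftrightarrow> (\<forall>S\<in>fam y. Q S)"
      unfolding F.persistent_iff_finitely_generated Q_def by (intro ball_cong refl) simp
    also have "\<dots> \<longleftrightarrow> (\<forall>l. y (to_nat l) \<noteq> 0 \<longrightarrow> Q (set l))"
      by (auto simp: fam_def)
    also have "\<dots> \<longleftrightarrow> W y"
      unfolding W_def Q_def ex
        all[of "\<lambda>T. fin_ab_normal free_group (generate free_group S) (generate free_group T) \<longrightarrow>
          (\<exists>S'\<in>fam y. S' \<subseteq> generate free_group T)" for S] ..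
    finally show ?thesis by simp
  qed
  define B where "B = {p \<in> space ((borel :: (nat \<Rightarrow> nat) measure) \<Otimes>\<^sub>M marked_groups_borel).
     (\<exists>l::letter list list. fst p (to_nat l) \<noteq> 0) \<and> W (fst p) \<and>
     (\<forall>l::letter list list. fst p (to_nat l) \<noteq> 0 \<longrightarrow> \<not> (\<forall>w\<in>set l. w \<in> snd p))}"
  have [measurable]: "(\<lambda>y::nat \<Rightarrow> nat. y n) \<in> borel \<rightarrow>\<^sub>M count_space UNIV" for n
    using measurable_product_coordinates[where 'b = nat and i = n]
    by (subst (asm) measurable_cong_sets[OF refl sets_borel_eq_count_space])
  have mW: "Measurable.pred borel W" unfolding W_def by measurable
  have "B \<in> sets (borel \<Otimes>\<^sub>M marked_groups_borel)"
    unfolding B_def using mW by measurable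
  moreover have "marked_groups - EG = snd ` B"
  proof (rule subset_antisym; rule subsetI)
    fix N assume N: "N \<in> marked_groups - EG"
    then have "N \<lhd> free_group" "\<not> elementary_amenable (free_group Mod N)"
      by (auto simp: marked_groups_def EG_def)
    then obtain \<F> where F: "\<F> \<noteq> {}" "persistent free_group \<F>" "\<forall>S\<in>\<F>. \<not> S \<subseteq> N"
      using not_elementary_amenable_Mod_iff[of N free_group] by auto
    \<comment> \<open>Every listing of a member is marked. Members are finite, so
      \<open>fam y\<close> gives the family back.\<close>
    define y :: "nat \<Rightarrow> nat" where "y n = (if set (from_nat n :: letter list list) \<in> \<F> then 1 else 0)" for n
    have y: "y (to_nat l) \<noteq> 0 \<longleftrightarrow> set l \<in> \<F>" for l :: "letter list list" by (simp add: y_def)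
    have fam: "fam y = \<F>"
      unfolding fam_def y using persistentD(1)[OF F(2)] finite_list by blast
    then have "W y" using W F(2) by simp
    moreover obtain S where "S \<in> \<F>" using F(1) by blast
    then have "\<exists>l::letter list list. y (to_nat l) \<noteq> 0"
      using y persistentD(1)[OF F(2)] finite_list by metis
    ultimately have "(y, N) \<in> B"
      using N F(3) y by (auto simp: B_def space_pair_measure space_marked_groups_borel subset_iff)
    then show "N \<in> snd ` B" by force
  next
    fix N assume "N \<in> snd ` B"
    then obtain y where y: "(y, N) \<in> B" by force
    then have N: "N \<in> marked_groups" by (auto simp: B_def space_pair_measure space_marked_groups_borel)
    have "persistent free_group (fam y)" using y W by (simp add: B_def)
    moreover have "fam y \<noteq> {}" using y by (auto simp: B_def fam_def)
    moreover have "\<forall>S\<in>fam y. \<not> S \<subseteq> N" using y by (auto simp: B_def fam_def subset_iff)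
    ultimately have "\<not> elementary_amenable (free_group Mod N)"
      using N by (subst not_elementary_amenable_Mod_iff) (auto simp: marked_groups_def)
    then show "N \<in> marked_groups - EG" using N by (simp add: EG_def)
  qed
  ultimately show ?thesis by (rule analytic_in_borelI)
qed

lemma co_analytic_EG: "co_analytic_in marked_groups_borel EG"
  unfolding co_analytic_in_def space_marked_groups_borel using EG_subset analytic_not_EG by simp

lemma co_analytic_EG_fg: "co_analytic_in marked_groups_borel (EG \<inter> fg_marked_groups)"
proof -
  have "marked_groups - EG \<inter> fg_marked_groups = (marked_groups - EG) \<union> (marked_groups - fg_marked_groups)"
    by blast
  moreover have "marked_groups - fg_marked_groups \<in> sets marked_groups_borel"
    using sets.compl_sets[OF sets_fg_marked_groups] by (simp add: space_marked_groups_borel)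
  ultimately show ?thesis
    unfolding co_analytic_in_def space_marked_groups_borel
    using EG_subset analytic_in_Un_sets[OF analytic_not_EG] by auto
qed

lemma co_analytic_EG_in_fg: "co_analytic_in fg_marked_groups_borel (EG \<inter> fg_marked_groups)"
proof -
  have "fg_marked_groups - EG \<inter> fg_marked_groups = (marked_groups - EG) \<inter> fg_marked_groups"
    using fg_marked_groups_subset by blast
  then show ?thesis
    unfolding co_analytic_in_def space_fg_marked_groups_borel
    using analytic_in_restrict_space[OF analytic_not_EG, of fg_marked_groups]
    by (simp add: fg_marked_groups_borel_def)
qed


section \<open>Well-foundedness is not Borel\<close>

text \<open>The projection of the closed set of branches \<open>(x, y)\<close> through the set of pairs \<open>R\<close>.\<close>

definition suslin :: "(nat list \<Rightarrow> nat list \<Rightarrow> bool) \<Rightarrow> (nat \<Rightarrow> nat) set" where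
  "suslin R = {x. \<exists>y. \<forall>n. R (map x [0..<Suc n]) (map y [0..<Suc n])}"

text \<open>The guard lets prefixes pass that are too short to show the coordinate.\<close>

lemma suslin_coordinate: "{x. x i \<in> A} = suslin (\<lambda>u v. i < length u \<longrightarrow> u ! i \<in> A)"
proof -
  have "x i \<in> A \<longleftrightarrow> (\<forall>n. i < Suc n \<longrightarrow> x i \<in> A)" for x :: "nat \<Rightarrow> nat" by auto
  then show ?thesis
    unfolding suslin_def by (simp del: upt_Suc)
qed

text \<open>The first entry of the new witness names the index \<open>i\<close>, and its tail is the
  witness for \<open>Rs i\<close>. The tail is one entry shorter, so \<open>u\<close> is truncated
  to match.\<close>

lemma suslin_UN:
  fixes Rs :: "nat \<Rightarrow> nat list \<Rightarrow> nat list \<Rightarrow> bool"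
  shows "\<exists>R. (\<Union>i. suslin (Rs i)) = suslin R"
proof -
  define R where "R u v = (case v of [] \<Rightarrow> True | i # v' \<Rightarrow> v' = [] \<or> Rs i (take (length v') u) v')" for u v
  have tk: "take (Suc n) (map x [0..<Suc (Suc n)]) = map x [0..<Suc n]" for n and x :: "nat \<Rightarrow> nat"
    by (simp add: take_map del: upt_Suc)
  have sp: "map y [0..<Suc n] = y 0 # map (\<lambda>m. y (Suc m)) [0..<n]" for y :: "nat \<Rightarrow> nat" and n
    by (rule map_upt_Suc)
  have "x \<in> (\<Union>i. suslin (Rs i)) \<longleftrightarrow> x \<in> suslin R" for x
  proof
    assume "x \<in> (\<Union>i. suslin (Rs i))"
    then obtain i y where y: "\<And>n. Rs i (map x [0..<Suc n]) (map y [0..<Suc n])"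
      unfolding suslin_def by blast
    define z where "z = case_nat i y"
    have "R (map x [0..<Suc n]) (map z [0..<Suc n])" for n
    proof (cases n)
      case (Suc k)
      have "map z [0..<Suc n] = i # map y [0..<Suc k]" unfolding sp[of z] by (simp add: z_def Suc)
      then show ?thesis using y[of k] tk[of k x] by (simp add: R_def Suc del: upt_Suc)
    qed (simp add: R_def z_def)
    then show "x \<in> suslin R" unfolding suslin_def by blast
  next
    assume "x \<in> suslin R"
    then obtain z where z: "\<And>n. R (map x [0..<Suc n]) (map z [0..<Suc n])"
      unfolding suslin_def by blast
    have "Rs (z 0) (map x [0..<Suc n]) (map (\<lambda>m. z (Suc m)) [0..<Suc n])" for n
      using z[of "Suc n"] tk[of n x] unfolding sp[of z "Suc n"] by (simp add: R_def del: upt_Suc)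
    then show "x \<in> (\<Union>i. suslin (Rs i))" unfolding suslin_def by blast
  qed
  then show ?thesis by blast
qed

text \<open>One witness interleaves the witnesses for all indices along the pairing function. Each
  finite condition is imposed once the prefixes are long enough to contain the entries it refers
  to.\<close>

lemma suslin_INT:
  fixes Rs :: "nat \<Rightarrow> nat list \<Rightarrow> nat list \<Rightarrow> bool"
  shows "\<exists>R. (\<Inter>i. suslin (Rs i)) = suslin R"
proof -
  define R where "R u v \<longleftrightarrow> (\<forall>i n. n < length u \<and> (\<forall>m\<le>n. prod_encode (i, m) < length v) \<longrightarrow>
     Rs i (take (Suc n) u) (map (\<lambda>m. v ! prod_encode (i, m)) [0..<Suc n]))" for u v :: "nat list"
  have "x \<in> (\<Inter>i. suslin (Rs i)) \<longleftrightarrow> x \<in> suslin R" for x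
  proof
    assume "x \<in> (\<Inter>i. suslin (Rs i))"
    then have "\<forall>i. \<exists>y. \<forall>n. Rs i (map x [0..<Suc n]) (map y [0..<Suc n])"
      unfolding suslin_def by blast
    then obtain y where y: "\<And>i n. Rs i (map x [0..<Suc n]) (map (y i) [0..<Suc n])" by metis
    define z where "z k = (case prod_decode k of (i, m) \<Rightarrow> y i m)" for k
    have "R (map x [0..<Suc N]) (map z [0..<Suc N])" for N
      unfolding R_def
    proof (intro allI impI)
      fix i n assume n: "n < length (map x [0..<Suc N]) \<and>
        (\<forall>m\<le>n. prod_encode (i, m) < length (map z [0..<Suc N]))"
      have "map (\<lambda>m. map z [0..<Suc N] ! prod_encode (i, m)) [0..<Suc n] = map (y i) [0..<Suc n]"
        using n by (intro map_cong refl) (auto simp: z_def simp del: upt_Suc)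
      moreover have "take (Suc n) (map x [0..<Suc N]) = map x [0..<Suc n]"
        using n by (simp add: take_map del: upt_Suc)
      ultimately show "Rs i (take (Suc n) (map x [0..<Suc N]))
          (map (\<lambda>m. map z [0..<Suc N] ! prod_encode (i, m)) [0..<Suc n])"
        using y[of i n] by (simp only:)
    qed
    then show "x \<in> suslin R" unfolding suslin_def by blast
  next
    assume "x \<in> suslin R"
    then obtain z where z: "\<And>n. R (map x [0..<Suc n]) (map z [0..<Suc n])"
      unfolding suslin_def by blast
    have "Rs i (map x [0..<Suc n]) (map (\<lambda>m. z (prod_encode (i, m))) [0..<Suc n])" for i n
    proof -
      \<comment> \<open>The sum bounds each code \<open>prod_encode (i, m)\<close> with
        \<open>m \<le> n\<close>, so the prefix of length \<open>Suc N\<close> contains all entries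
        needed.\<close>
      define N where "N = n + (\<Sum>m\<le>n. prod_encode (i, m))"
      have le: "prod_encode (i, m) \<le> N" if "m \<le> n" for m
        unfolding N_def using that by (intro trans_le_add2 member_le_sum) auto
      have "Rs i (take (Suc n) (map x [0..<Suc N]))
          (map (\<lambda>m. map z [0..<Suc N] ! prod_encode (i, m)) [0..<Suc n])"
        using z[of N] le unfolding R_def by (auto simp: N_def less_Suc_eq_le simp del: upt_Suc)
      moreover have "map (\<lambda>m. map z [0..<Suc N] ! prod_encode (i, m)) [0..<Suc n] =
          map (\<lambda>m. z (prod_encode (i, m))) [0..<Suc n]"
        using le by (intro map_cong refl) (auto simp: less_Suc_eq_le simp del: upt_Suc)
      moreover have "take (Suc n) (map x [0..<Suc N]) = map x [0..<Suc n]"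
        by (simp add: take_map N_def del: upt_Suc)
      ultimately show ?thesis by (simp only:)
    qed
    then show "x \<in> (\<Inter>i. suslin (Rs i))" unfolding suslin_def by blast
  qed
  then show ?thesis by blast
qed

abbreviation baire_measure :: "(nat \<Rightarrow> nat) measure" where
  "baire_measure \<equiv> Pi\<^sub>M UNIV (\<lambda>_. count_space UNIV)"

text \<open>A Suslin set need not have a Suslin complement, so the induction over the sigma-algebra
  carries both. For a union, the complement needs the intersection lemma.\<close>

lemma baire_sets_suslin:
  assumes "B \<in> sets baire_measure"
  shows "\<exists>R. B = suslin R" "\<exists>R. - B = suslin R"
proof -
  have "B \<in> sigma_sets UNIV {{f. f i \<in> A} | i A. True}"
    using assms by (simp add: sets_PiM_single PiE_UNIV_domain)
  then have "(\<exists>R. B = suslin R) \<and> (\<exists>R. - B = suslin R)"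
  proof (induction rule: sigma_sets.induct)
    case (Basic a)
    then obtain i :: nat and A :: "nat set" where a: "a = {f. f i \<in> A}" by blast
    have "- a = {f. f i \<in> - A}" by (auto simp: a)
    also have "\<dots> = suslin (\<lambda>u v. i < length u \<longrightarrow> u ! i \<in> - A)" by (rule suslin_coordinate)
    finally have "\<exists>R. - a = suslin R" by blast
    moreover have "\<exists>R. a = suslin R" unfolding a suslin_coordinate by blast
    ultimately show ?case by blast
  next
    case Empty
    have "{} = {f :: nat \<Rightarrow> nat. f 0 \<in> {}}" by simp
    also have "\<dots> = suslin (\<lambda>u v. 0 < length u \<longrightarrow> u ! 0 \<in> {})" by (rule suslin_coordinate)
    finally have 1: "\<exists>R. {} = suslin R" by blast
    have "- {} = {f :: nat \<Rightarrow> nat. f 0 \<in> UNIV}" by simp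
    also have "\<dots> = suslin (\<lambda>u v. 0 < length u \<longrightarrow> u ! 0 \<in> UNIV)" by (rule suslin_coordinate)
    finally have "\<exists>R. - {} = suslin R" by blast
    with 1 show ?case by (rule conjI)
  next
    case (Compl a)
    then show ?case by (simp add: Compl_eq_Diff_UNIV[symmetric])
  next
    case (Union a)
    then obtain R R' where R: "\<And>i. a i = suslin (R i)" "\<And>i. - a i = suslin (R' i)" by metis
    have "(\<Union>i. a i) = (\<Union>i. suslin (R i))" "- (\<Union>i. a i) = (\<Inter>i. suslin (R' i))"
      using R by auto
    then show ?case using suslin_UN[of R] suslin_INT[of R'] by metis
  qed
  then show "\<exists>R. B = suslin R" "\<exists>R. - B = suslin R" by blast+
qed

text \<open>The edges of the tree of attempts to show that \<open>e\<close> belongs to the analytic set coded by \<open>e\<close>.\<close>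

definition branch_edge :: "(nat \<Rightarrow> nat) \<Rightarrow> nat list \<Rightarrow> nat list \<Rightarrow> bool" where
  "branch_edge e v v' \<longleftrightarrow>
     (\<exists>k. v' = v @ [k] \<and> e (to_nat (map e [0..<length v'], v')) \<noteq> 0)"

text \<open>A node outside the accessible part has a child outside it, so dependent choice yields an
  infinite chain; its nodes are the prefixes of one sequence \<open>y\<close>. Conversely, no prefix
  of an infinite branch is accessible.\<close>

lemma not_accp_branch_edge_iff:
  "\<not> Wellfounded.accp (\<lambda>v' v. branch_edge e v v') [] \<longleftrightarrow>
     (\<exists>y::nat \<Rightarrow> nat. \<forall>n. e (to_nat (map e [0..<Suc n], map y [0..<Suc n])) \<noteq> 0)" (is "\<not> ?acc [] \<longleftrightarrow> _")
proof
  assume "\<not> ?acc []"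
  then have "\<exists>f. \<forall>n. (\<not> ?acc (f n) \<and> length (f n) = n) \<and> branch_edge e (f n) (f (Suc n))"
  proof (intro dependent_nat_choice)
    fix v n assume v: "\<not> ?acc v \<and> length v = n"
    then obtain v' where "branch_edge e v v'" "\<not> ?acc v'" by (meson accp.accI)
    then show "\<exists>v'. (\<not> ?acc v' \<and> length v' = Suc n) \<and> branch_edge e v v'"
      using v by (auto simp: branch_edge_def)
  qed auto
  then obtain f where f: "\<And>n. length (f n) = n" "\<And>n. branch_edge e (f n) (f (Suc n))" by blast
  define y where "y n = last (f (Suc n))" for n
  have fy: "f n = map y [0..<n]" for n
  proof (induction n)
    case 0 then show ?case using f(1)[of 0] by simp
  next
    case (Suc n)
    obtain k where "f (Suc n) = f n @ [k]" using f(2)[of n] by (auto simp: branch_edge_def)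
    then show ?case using Suc by (simp add: y_def)
  qed
  have "e (to_nat (map e [0..<Suc n], map y [0..<Suc n])) \<noteq> 0" for n
    using f(2)[of n] f(1)[of "Suc n"] unfolding branch_edge_def fy[symmetric] by metis
  then show "\<exists>y::nat \<Rightarrow> nat. \<forall>n. e (to_nat (map e [0..<Suc n], map y [0..<Suc n])) \<noteq> 0" by blast
next
  assume "\<exists>y::nat \<Rightarrow> nat. \<forall>n. e (to_nat (map e [0..<Suc n], map y [0..<Suc n])) \<noteq> 0"
  then obtain y :: "nat \<Rightarrow> nat" where y: "\<And>n. e (to_nat (map e [0..<Suc n], map y [0..<Suc n])) \<noteq> 0" by blast
  have step: "branch_edge e (map y [0..<n]) (map y [0..<Suc n])" for n
    unfolding branch_edge_def using y[of n] by (intro exI[of _ "y n"]) simp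
  have "\<forall>n. v \<noteq> map y [0..<n]" if "?acc v" for v
    using that
  proof (induction rule: accp.induct)
    case (accI v)
    show ?case
    proof (intro allI notI)
      fix n assume "v = map y [0..<n]"
      then show False using accI.IH[of "map y [0..<Suc n]"] step[of n] by blast
    qed
  qed
  from this[of "[]"] show "\<not> ?acc []" by (metis list.map(1) upt_0)
qed

text \<open>If the set were Borel it would be \<open>suslin R\<close> for some \<open>R\<close>. For
  \<open>e\<close> the characteristic function of \<open>R\<close>, being outside the set means
  having a branch, which says exactly that \<open>e\<close> is in \<open>suslin R\<close>.\<close>

theorem accp_branch_edge_not_borel:
  "{e. Wellfounded.accp (\<lambda>v' v. branch_edge e v v') []} \<notin> sets baire_measure" (is "?W \<notin> _")
proof
  assume "?W \<in> sets baire_measure"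
  then obtain R where R: "?W = suslin R" using baire_sets_suslin(1) by blast
  define e :: "nat \<Rightarrow> nat" where
    "e n = (if (case from_nat n of (u, v) \<Rightarrow> R u v) then 1 else 0)" for n
  have e: "e (to_nat (u, v)) \<noteq> 0 \<longleftrightarrow> R u v" for u v by (simp add: e_def)
  have "e \<notin> ?W \<longleftrightarrow> e \<in> suslin R"
    unfolding suslin_def mem_Collect_eq not_accp_branch_edge_iff e ..
  then show False using R by blast
qed


section \<open>Permutation groups attached to graphs\<close>

definition perm_group :: "('a \<Rightarrow> 'a) monoid" where
  "perm_group = \<lparr>carrier = {f. bij f}, mult = (\<circ>), one = id\<rparr>"

lemma carrier_perm_group [simp]: "carrier perm_group = {f. bij f}"
  and mult_perm_group [simp]: "f \<otimes>\<^bsub>perm_group\<^esub> g = f \<circ> g"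
  and one_perm_group [simp]: "\<one>\<^bsub>perm_group\<^esub> = id"
  by (simp_all add: perm_group_def)

lemma group_perm_group: "group perm_group"
proof (rule groupI)
  fix f :: "'a \<Rightarrow> 'a" assume "f \<in> carrier perm_group"
  then show "\<exists>g\<in>carrier perm_group. g \<otimes>\<^bsub>perm_group\<^esub> f = \<one>\<^bsub>perm_group\<^esub>"
    by (intro bexI[of _ "inv_into UNIV f"]) (auto simp: bij_imp_bij_inv bij_is_inj)
qed (auto simp: bij_comp comp_assoc)

interpretation perm: group "perm_group :: ('a \<Rightarrow> 'a) monoid"
  by (rule group_perm_group)

lemma inv_perm_group_apply:
  assumes "bij f"
  shows "f ((inv\<^bsub>perm_group\<^esub> f) x) = x" "(inv\<^bsub>perm_group\<^esub> f) (f x) = x"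
  using perm.r_inv[of f] perm.l_inv[of f] assms by (simp_all add: fun_eq_iff)

type_synonym 'n point = "(int \<times> 'n) list"

fun shift :: "int \<Rightarrow> 'n point \<Rightarrow> 'n point" where
  "shift k [] = []"
| "shift k (p # \<omega>) = (fst p + k, snd p) # \<omega>"

text \<open>The group of the node \<open>a\<close> is generated by \<open>shift 1\<close> and \<open>branch E 1 a\<close>. In the block of points
  starting with \<open>p = (i, b)\<close>, where \<open>b\<close> is a child of \<open>a\<close>, the second generator acts as the first
  generator of the child if \<open>i = n\<close> and as its second generator if \<open>i = 2 n + 1\<close>, where \<open>n\<close> is the code
  of \<open>b\<close>. The differences \<open>n + 1\<close> are distinct, so two different translates of \<open>branch E 1 a\<close> fail to
  commute on finitely many blocks only. All positions are nonnegative, which allows to shift them away.\<close>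

fun branch :: "('n::countable \<Rightarrow> 'n \<Rightarrow> bool) \<Rightarrow> int \<Rightarrow> 'n \<Rightarrow> 'n point \<Rightarrow> 'n point" where
  "branch E k a [] = []"
| "branch E k a (p # \<omega>) = p #
     (if E a (snd p) \<and> fst p = int (to_nat (snd p)) then shift k \<omega>
      else if E a (snd p) \<and> fst p = 2 * int (to_nat (snd p)) + 1 then branch E k (snd p) \<omega>
      else \<omega>)"

lemma shift_0 [simp]: "shift 0 = id"
proof
  show "shift 0 \<omega> = id \<omega>" for \<omega> :: "'a point" by (cases \<omega>) auto
qed

lemma shift_shift [simp]: "shift k (shift l \<omega>) = shift (k + l) \<omega>"
  by (cases \<omega>) auto

lemma branch_minus: "branch E (- k) a (branch E k a \<omega>) = \<omega>"
proof (induction \<omega> arbitrary: a)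
  case (Cons p \<omega>)
  then show ?case by (cases p) auto
qed simp

lemma bij_shift: "bij (shift k)"
  by (rule o_bij[of "shift (- k)"]) (auto simp: fun_eq_iff)

lemma bij_branch: "bij (branch E k a)"
  using branch_minus[of E k a] branch_minus[of E "- k" a]
  by (intro o_bij[of "branch E (- k) a"]) (auto simp: fun_eq_iff)

lemma inv_shift: "inv\<^bsub>perm_group\<^esub> (shift k) = shift (- k)"
  by (rule perm.inv_equality) (auto simp: bij_shift fun_eq_iff)

lemma inv_branch: "inv\<^bsub>perm_group\<^esub> (branch E k a) = branch E (- k) a"
  by (rule perm.inv_equality) (auto simp: bij_branch branch_minus fun_eq_iff)

definition tree_group :: "('n::countable \<Rightarrow> 'n \<Rightarrow> bool) \<Rightarrow> 'n \<Rightarrow> ('n point \<Rightarrow> 'n point) set" where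
  "tree_group E a = generate perm_group {shift 1, branch E 1 a}"

lemma tree_group_subgroup: "subgroup (tree_group E a) perm_group"
  unfolding tree_group_def by (rule perm.generate_is_subgroup) (simp add: bij_shift bij_branch)

lemma shift_in_tree_group: "shift 1 \<in> tree_group E a" "shift (- 1) \<in> tree_group E a"
  unfolding tree_group_def
  using generate.incl[of "shift 1" "{shift 1, branch E 1 a}" perm_group]
    generate.inv[of "shift 1" "{shift 1, branch E 1 a}" perm_group]
  by (simp_all add: inv_shift)

lemma branch_in_tree_group: "branch E 1 a \<in> tree_group E a" "branch E (- 1) a \<in> tree_group E a"
  unfolding tree_group_def
  using generate.incl[of "branch E 1 a" "{shift 1, branch E 1 a}" perm_group]
    generate.inv[of "branch E 1 a" "{shift 1, branch E 1 a}" perm_group]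
  by (simp_all add: inv_branch)

section \<open>The two-generated marked group of a node\<close>

fun act :: "('n::countable \<Rightarrow> 'n \<Rightarrow> bool) \<Rightarrow> 'n \<Rightarrow> letter \<Rightarrow> 'n point \<Rightarrow> 'n point" where
  "act E a (i, s) = (if i = 0 then shift (if s then 1 else - 1)
     else if i = 1 then branch E (if s then 1 else - 1) a else id)"

definition word_act :: "('n::countable \<Rightarrow> 'n \<Rightarrow> bool) \<Rightarrow> 'n \<Rightarrow> letter list \<Rightarrow> 'n point \<Rightarrow> 'n point" where
  "word_act E a w \<omega> = foldr (act E a) w \<omega>"

lemma word_act_Nil: "word_act E a [] = id"
  and word_act_Cons: "word_act E a (x # w) = act E a x \<circ> word_act E a w"
  and word_act_append: "word_act E a (u @ v) = word_act E a u \<circ> word_act E a v"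
  by (simp_all add: word_act_def fun_eq_iff)

lemma act_inv_letter: "act E a x (act E a (inv_letter x) \<omega>) = \<omega>"
  using branch_minus[of E 1 a] branch_minus[of E "- 1" a]
  by (cases x) (simp add: inv_letter_def)

lemma word_act_push_letter: "word_act E a (push_letter x w) = act E a x \<circ> word_act E a w"
  by (cases w) (auto simp: word_act_Nil word_act_Cons act_inv_letter fun_eq_iff)

lemma word_act_reduce: "word_act E a (reduce w) = word_act E a w"
  by (induction w) (simp_all add: reduce_def word_act_push_letter word_act_Cons)

lemma word_act_in_tree_group: "word_act E a w \<in> tree_group E a"
proof (induction w)
  case Nil
  show ?case
    using subgroup.one_closed[OF tree_group_subgroup, of E a]
    by (simp only: word_act_Nil one_perm_group)
next
  case (Cons x w)
  have "id \<in> tree_group E a"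
    using subgroup.one_closed[OF tree_group_subgroup, of E a] by simp
  moreover have "act E a x = (if fst x = 0 then shift (if snd x then 1 else - 1)
      else if fst x = 1 then branch E (if snd x then 1 else - 1) a else id)"
    by (cases x) (simp add: fun_eq_iff)
  ultimately have "act E a x \<in> tree_group E a"
    by (simp add: shift_in_tree_group branch_in_tree_group)
  then show ?case
    using subgroup.m_closed[OF tree_group_subgroup _ Cons, of "act E a x"]
    by (simp only: word_act_Cons mult_perm_group)
qed

lemma tree_group_word_act:
  assumes "f \<in> tree_group E a"
  obtains w where "reduced w" "f = word_act E a w"
proof -
  have "\<exists>w. f = word_act E a w"
    using assms unfolding tree_group_def
  proof (induction f rule: generate.induct)
    case one
    show ?case by (intro exI[of _ "[]"]) (simp add: word_act_Nil)
  next
    case (incl h)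
    then show ?case
      by (auto intro: exI[of _ "[(0, True)]"] exI[of _ "[(1, True)]"] simp: word_act_Nil word_act_Cons)
  next
    case (inv h)
    then show ?case
      by (auto intro: exI[of _ "[(0, False)]"] exI[of _ "[(1, False)]"]
          simp: word_act_Nil word_act_Cons inv_shift inv_branch)
  next
    case (eng h1 h2)
    then show ?case by (metis mult_perm_group word_act_append)
  qed
  then obtain w where "f = word_act E a w" by blast
  then show ?thesis using that[of "reduce w"] by (simp add: reduced_reduce word_act_reduce)
qed

definition marked_tree_group :: "('n::countable \<Rightarrow> 'n \<Rightarrow> bool) \<Rightarrow> 'n \<Rightarrow> letter list set" where
  "marked_tree_group E a = {w. reduced w \<and> (\<forall>\<omega>. word_act E a w \<omega> = \<omega>)}"

lemma group_hom_word_act: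
  "group_hom free_group (perm_group\<lparr>carrier := tree_group E a\<rparr>) (word_act E a)"
proof (intro group_hom.intro group_hom_axioms.intro group_free_group
    perm.subgroup_imp_group tree_group_subgroup)
  show "word_act E a \<in> hom free_group (perm_group\<lparr>carrier := tree_group E a\<rparr>)"
    by (auto simp: hom_def free_group_def word_act_in_tree_group word_act_reduce word_act_append)
qed

lemma kernel_word_act:
  "kernel free_group (perm_group\<lparr>carrier := tree_group E a\<rparr>) (word_act E a) = marked_tree_group E a"
  by (auto simp: kernel_def marked_tree_group_def free_group_def fun_eq_iff)

lemma marked_tree_group_normal: "marked_tree_group E a \<lhd> free_group"
  using group_hom.normal_kernel[OF group_hom_word_act, of E a] by (simp add: kernel_word_act)

lemma marked_tree_group_fg: "marked_tree_group E a \<in> fg_marked_groups"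
proof -
  have "gen i \<in> marked_tree_group E a" if "i \<ge> 2" for i
    using that by (simp add: gen_def marked_tree_group_def reduced_def word_act_Nil word_act_Cons)
  then have "marked_tree_group E a \<in> (\<Inter>i\<in>{2..}. {N \<in> marked_groups. gen i \<in> N})"
    using marked_tree_group_normal by (auto simp: marked_groups_def)
  then show ?thesis unfolding fg_marked_groups_def by (intro UN_I[of 2]) auto
qed

text \<open>By the first isomorphism theorem for the action of words, the marked group is isomorphic
  to the permutation group of the node.\<close>

lemma marked_tree_group_EG_iff:
  "marked_tree_group E a \<in> EG \<longleftrightarrow> elementary_amenable (perm_group\<lparr>carrier := tree_group E a\<rparr>)"
proof -
  interpret h: group_hom free_group "perm_group\<lparr>carrier := tree_group E a\<rparr>" "word_act E a"
    by (rule group_hom_word_act)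
  have "word_act E a ` carrier free_group = tree_group E a"
  proof (intro equalityI subsetI)
    fix f assume "f \<in> tree_group E a"
    then obtain w where "reduced w" "f = word_act E a w" by (rule tree_group_word_act)
    then show "f \<in> word_act E a ` carrier free_group" by (simp add: free_group_def)
  qed (use word_act_in_tree_group in blast)
  then have iso: "free_group Mod marked_tree_group E a \<cong> perm_group\<lparr>carrier := tree_group E a\<rparr>"
    using h.FactGroup_iso by (simp add: kernel_word_act)
  have "group (free_group Mod marked_tree_group E a)"
    by (rule normal.factorgroup_is_group[OF marked_tree_group_normal])
  then show ?thesis
    using elementary_amenable_iso_iff[OF _ h.H.is_group iso] marked_tree_group_normal[of E a]
    by (simp add: EG_def marked_groups_def)
qed

section \<open>Blocks, degree and support of the elements of a node's group\<close>

lemma countable_tree_group: "countable (tree_group E a)"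
proof -
  have "tree_group E a \<subseteq> range (word_act E a)" using tree_group_word_act by blast
  then show ?thesis by (rule countable_subset) simp
qed

text \<open>\<open>f\<close> moves the block of \<open>p\<close> by \<open>s\<close> and acts inside it as \<open>\<phi> p\<close>, which is a word in only one of the two
  generators of the child unless \<open>p\<close> is within distance \<open>m\<close> of both of its positions.\<close>

definition tame :: "('n::countable \<Rightarrow> 'n \<Rightarrow> bool) \<Rightarrow> 'n \<Rightarrow> int \<Rightarrow> (int \<times> 'n \<Rightarrow> 'n point \<Rightarrow> 'n point) \<Rightarrow>
    int \<Rightarrow> ('n point \<Rightarrow> 'n point) \<Rightarrow> bool" where
  "tame E a s \<phi> m f \<longleftrightarrow> 0 \<le> m \<and> f [] = [] \<and> (\<forall>p \<omega>. f (p # \<omega>) = (fst p + s, snd p) # \<phi> p \<omega>) \<and>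
    (\<forall>p. \<phi> p \<in> tree_group E (snd p)) \<and> (\<forall>p. \<not> E a (snd p) \<longrightarrow> \<phi> p = id) \<and>
    (\<forall>p. m < \<bar>fst p - int (to_nat (snd p))\<bar> \<longrightarrow> \<phi> p \<in> generate perm_group {branch E 1 (snd p)}) \<and>
    (\<forall>p. m < \<bar>fst p - (2 * int (to_nat (snd p)) + 1)\<bar> \<longrightarrow> \<phi> p \<in> generate perm_group {shift 1})"

lemma tameD:
  assumes "tame E a s \<phi> m f"
  shows "0 \<le> m" "f [] = []" "f (p # \<omega>) = (fst p + s, snd p) # \<phi> p \<omega>"
    "\<phi> p \<in> tree_group E (snd p)" "\<not> E a (snd p) \<Longrightarrow> \<phi> p = id"
    "m < \<bar>fst p - int (to_nat (snd p))\<bar> \<Longrightarrow> \<phi> p \<in> generate perm_group {branch E 1 (snd p)}"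
    "m < \<bar>fst p - (2 * int (to_nat (snd p)) + 1)\<bar> \<Longrightarrow> \<phi> p \<in> generate perm_group {shift 1}"
  using assms unfolding tame_def by blast+

lemma id_in_generate_perm_group: "id \<in> generate perm_group S"
  using generate.one[of perm_group S] by simp

lemma id_in_tree_group: "id \<in> tree_group E a"
  unfolding tree_group_def by (rule id_in_generate_perm_group)

text \<open>The inner map of \<open>f\<close> is read off at the block to which \<open>g\<close> has
  moved \<open>p\<close>, so the window \<open>m\<close> around the two special positions grows by
  the size of the shift of \<open>g\<close>.\<close>

lemma tame_comp:
  assumes f: "tame E a s \<phi> m f" and g: "tame E a s' \<phi>' m' g"
  shows "tame E a (s + s') (\<lambda>p. \<phi> (fst p + s', snd p) \<circ> \<phi>' p) (m + m' + \<bar>s'\<bar>) (f \<circ> g)"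
  unfolding tame_def
proof (intro conjI allI impI)
  note F = tameD[OF f] and G = tameD[OF g]
  have eng: "h \<circ> k \<in> generate perm_group S" if "h \<in> generate perm_group S" "k \<in> generate perm_group S"
    for h k :: "'a point \<Rightarrow> 'a point" and S
    using generate.eng[OF that] by simp
  show "0 \<le> m + m' + \<bar>s'\<bar>" using F(1) G(1) by simp
  show "(f \<circ> g) [] = []" by (simp add: F(2) G(2))
  fix p :: "int \<times> 'a"
  show "(f \<circ> g) (p # \<omega>) = (fst p + (s + s'), snd p) # (\<phi> (fst p + s', snd p) \<circ> \<phi>' p) \<omega>" for \<omega>
    by (simp add: F(3) G(3))
  show "\<phi> (fst p + s', snd p) \<circ> \<phi>' p \<in> tree_group E (snd p)"
    using F(4)[of "(fst p + s', snd p)"] G(4)[of p] unfolding tree_group_def by (intro eng) simp_all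
  show "\<phi> (fst p + s', snd p) \<circ> \<phi>' p = id" if "\<not> E a (snd p)"
    using F(5)[of "(fst p + s', snd p)"] G(5)[of p] that by simp
  show "\<phi> (fst p + s', snd p) \<circ> \<phi>' p \<in> generate perm_group {branch E 1 (snd p)}"
    if "m + m' + \<bar>s'\<bar> < \<bar>fst p - int (to_nat (snd p))\<bar>"
    using F(6)[of "(fst p + s', snd p)"] G(6)[of p] F(1) G(1) that by (intro eng) simp_all
  show "\<phi> (fst p + s', snd p) \<circ> \<phi>' p \<in> generate perm_group {shift 1}"
    if "m + m' + \<bar>s'\<bar> < \<bar>fst p - (2 * int (to_nat (snd p)) + 1)\<bar>"
    using F(7)[of "(fst p + s', snd p)"] G(7)[of p] F(1) G(1) that by (intro eng) simp_all
qed

lemma tame_shift: "tame E a k (\<lambda>_. id) 0 (shift k)"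
  by (simp add: tame_def id_in_generate_perm_group id_in_tree_group)

lemma tame_branch:
  assumes "k = 1 \<or> k = - 1"
  shows "\<exists>\<phi>. tame E a 0 \<phi> 0 (branch E k a)"
proof -
  define \<phi> :: "int \<times> 'a \<Rightarrow> 'a point \<Rightarrow> 'a point" where
    "\<phi> p = (if E a (snd p) \<and> fst p = int (to_nat (snd p)) then shift k
      else if E a (snd p) \<and> fst p = 2 * int (to_nat (snd p)) + 1 then branch E k (snd p) else id)" for p
  have 1: "shift k \<in> generate perm_group {shift 1}"
    using assms generate.incl[of "shift 1" "{shift 1}" perm_group]
      generate.inv[of "shift 1" "{shift 1}" perm_group] by (auto simp: inv_shift)
  have 2: "branch E k b \<in> generate perm_group {branch E 1 b}" for b
    using assms generate.incl[of "branch E 1 b" "{branch E 1 b}" perm_group]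
      generate.inv[of "branch E 1 b" "{branch E 1 b}" perm_group] by (auto simp: inv_branch)
  have "tame E a 0 \<phi> 0 (branch E k a)"
    using assms 1 2 shift_in_tree_group branch_in_tree_group
    by (auto simp: tame_def \<phi>_def id_in_generate_perm_group id_in_tree_group)
  then show ?thesis by blast
qed

lemma tree_group_tame:
  assumes "f \<in> tree_group E a"
  shows "\<exists>s \<phi> m. tame E a s \<phi> m f"
  using assms unfolding tree_group_def
proof (induction f rule: generate.induct)
  case one
  show ?case using tame_shift[of E a 0] unfolding shift_0 one_perm_group by (intro exI)
next
  case (incl h)
  then consider "h = shift 1" | "h = branch E 1 a" by blast
  then show ?case
  proof cases
    case 1
    show ?thesis unfolding 1 by (intro exI) (rule tame_shift)
  next
    case 2
    show ?thesis unfolding 2 by (rule exI) (rule exE[OF tame_branch[of 1 E a]]; blast)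
  qed
next
  case (inv h)
  then consider "h = shift 1" | "h = branch E 1 a" by blast
  then show ?case
  proof cases
    case 1
    show ?thesis unfolding 1 inv_shift by (intro exI) (rule tame_shift)
  next
    case 2
    show ?thesis unfolding 2 inv_branch by (rule exI) (rule exE[OF tame_branch[of "- 1" E a]]; blast)
  qed
next
  case (eng h1 h2)
  then show ?case unfolding mult_perm_group by (blast intro: tame_comp)
qed

text \<open>An element of a tree group moves all blocks by the same amount, so one test block
  detects it and its label may be left \<open>undefined\<close>.\<close>

definition degree :: "('n point \<Rightarrow> 'n point) \<Rightarrow> int" where
  "degree f = fst (hd (f [(0, undefined)]))"

definition part :: "('n point \<Rightarrow> 'n point) \<Rightarrow> int \<times> 'n \<Rightarrow> 'n point \<Rightarrow> 'n point" where
  "part f p \<omega> = tl (f (p # \<omega>))"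

lemma tame_degree: "tame E a s \<phi> m f \<Longrightarrow> degree f = s"
  by (simp add: tameD degree_def)

lemma tame_part: "tame E a s \<phi> m f \<Longrightarrow> part f = \<phi>"
  by (simp add: tameD part_def fun_eq_iff)

lemma tree_group_tameE:
  assumes "f \<in> tree_group E a"
  obtains m where "tame E a (degree f) (part f) m f"
  using tree_group_tame[OF assms] tame_degree tame_part by metis

lemma degree_comp:
  assumes "f \<in> tree_group E a" "g \<in> tree_group E a"
  shows "degree (f \<circ> g) = degree f + degree g"
proof -
  obtain m m' where "tame E a (degree f) (part f) m f" "tame E a (degree g) (part g) m' g"
    using tree_group_tameE[OF assms(1)] tree_group_tameE[OF assms(2)] by meson
  from tame_degree[OF tame_comp[OF this]] show ?thesis .
qed

lemma group_hom_degree: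
  "group_hom (perm_group\<lparr>carrier := tree_group E a\<rparr>) integer_group degree"
  by (intro group_hom.intro group_hom_axioms.intro perm.subgroup_imp_group tree_group_subgroup
      group_integer_group) (auto simp: hom_def degree_comp)

definition base_group :: "('n::countable \<Rightarrow> 'n \<Rightarrow> bool) \<Rightarrow> 'n \<Rightarrow> ('n point \<Rightarrow> 'n point) set" where
  "base_group E a = {f \<in> tree_group E a. degree f = 0}"

lemma kernel_degree:
  "kernel (perm_group\<lparr>carrier := tree_group E a\<rparr>) integer_group degree = base_group E a"
  by (auto simp: kernel_def base_group_def)

lemma base_group_subgroup: "subgroup (base_group E a) perm_group"
  using group_hom.subgroup_kernel[OF group_hom_degree, of E a] perm.incl_subgroup[OF tree_group_subgroup]
  by (simp add: kernel_degree)

lemma base_group_apply: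
  assumes "f \<in> base_group E a"
  shows "f [] = []" "f (p # \<omega>) = p # part f p \<omega>"
    "part f p \<in> tree_group E (snd p)" "\<not> E a (snd p) \<Longrightarrow> part f p = id"
proof -
  obtain m where m: "tame E a 0 (part f) m f"
    using assms tree_group_tameE[of f E a] unfolding base_group_def by auto
  show "f [] = []" "f (p # \<omega>) = p # part f p \<omega>"
    "part f p \<in> tree_group E (snd p)" "\<not> E a (snd p) \<Longrightarrow> part f p = id"
    using tameD(2)[OF m] tameD(3)[OF m, of p \<omega>] tameD(4)[OF m, of p] tameD(5)[OF m, of p]
    by simp_all
qed

lemma part_comp:
  assumes "g \<in> base_group E a"
  shows "part (f \<circ> g) p = part f p \<circ> part g p"
  by (rule ext) (simp only: part_def[of f] part_def[of "f \<circ> g"] comp_apply base_group_apply(2)[OF assms])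

lemma part_id [simp]: "part id p = id"
  by (simp add: part_def fun_eq_iff)

lemma base_group_bij: "f \<in> base_group E a \<Longrightarrow> bij f"
  using subgroup.subset[OF base_group_subgroup] by auto

lemma base_group_inv:
  "f \<in> base_group E a \<Longrightarrow> inv\<^bsub>perm_group\<^esub> f \<in> base_group E a"
  by (rule subgroup.m_inv_closed[OF base_group_subgroup])

lemma base_group_comp:
  "f \<in> base_group E a \<Longrightarrow> g \<in> base_group E a \<Longrightarrow> f \<circ> g \<in> base_group E a"
  using subgroup.m_closed[OF base_group_subgroup] by (metis mult_perm_group)

lemma part_inv:
  assumes "f \<in> base_group E a"
  shows "part f p \<circ> part (inv\<^bsub>perm_group\<^esub> f) p = id"
  using part_comp[OF base_group_inv[OF assms], of f p] perm.r_inv[of f] base_group_bij[OF assms]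
  by simp

definition supp :: "('n point \<Rightarrow> 'n point) \<Rightarrow> (int \<times> 'n) set" where
  "supp f = {p. part f p \<noteq> id}"

lemma supp_comp: "g \<in> base_group E a \<Longrightarrow> supp (f \<circ> g) \<subseteq> supp f \<union> supp g"
  by (auto simp: supp_def part_comp)

lemma supp_inv: "f \<in> base_group E a \<Longrightarrow> supp (inv\<^bsub>perm_group\<^esub> f) \<subseteq> supp f"
  unfolding supp_def using part_inv[of f E a] by (metis (mono_tags, lifting) id_comp mem_Collect_eq subsetI)

lemma supp_id [simp]: "supp id = {}"
  by (simp add: supp_def)

text \<open>The hypotheses say that \<open>Q\<close> is an ideal of sets. It is applied to finite
  supports and to supports inside an initial segment of an enumeration of the blocks.\<close>

lemma base_group_supp_subgroup:
  assumes "Q {}" "\<And>A B. Q A \<Longrightarrow> B \<subseteq> A \<Longrightarrow> Q B" "\<And>A B. Q A \<Longrightarrow> Q B \<Longrightarrow> Q (A \<union> B)"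
  shows "subgroup {f \<in> base_group E a. Q (supp f)} perm_group"
proof (rule perm.subgroupI)
  show "{f \<in> base_group E a. Q (supp f)} \<subseteq> carrier perm_group" using base_group_bij by auto
  have "id \<in> base_group E a" using subgroup.one_closed[OF base_group_subgroup, of E a] by simp
  then have "id \<in> {f \<in> base_group E a. Q (supp f)}" using assms(1) by simp
  then show "{f \<in> base_group E a. Q (supp f)} \<noteq> {}" by (rule ex_in_conv[THEN iffD1, OF exI])
  fix f assume "f \<in> {f \<in> base_group E a. Q (supp f)}"
  then have f: "f \<in> base_group E a" "Q (supp f)" by simp_all
  show "inv\<^bsub>perm_group\<^esub> f \<in> {f \<in> base_group E a. Q (supp f)}"
    using base_group_inv[OF f(1)] assms(2)[OF f(2) supp_inv[OF f(1)]] by simp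
  fix g assume "g \<in> {f \<in> base_group E a. Q (supp f)}"
  then have g: "g \<in> base_group E a" "Q (supp g)" by simp_all
  show "f \<otimes>\<^bsub>perm_group\<^esub> g \<in> {f \<in> base_group E a. Q (supp f)}"
    using base_group_comp[OF f(1) g(1)] assms(2)[OF assms(3)[OF f(2) g(2)] supp_comp[OF g(1)]]
    unfolding mult_perm_group by simp
qed

lemma generate_singleton_commute:
  assumes "bij c" "f \<in> generate perm_group {c}" "g \<in> generate perm_group {c}"
  shows "f \<circ> g = g \<circ> f"
proof -
  obtain i j :: int where "f = c [^]\<^bsub>perm_group\<^esub> i" "g = c [^]\<^bsub>perm_group\<^esub> j"
    using assms perm.generate_pow[of c] by auto
  moreover have "c [^]\<^bsub>perm_group\<^esub> (i + j) = c [^]\<^bsub>perm_group\<^esub> (j + i)" by (simp add: add.commute)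
  ultimately show ?thesis using assms(1) by (simp add: perm.int_pow_mult)
qed

text \<open>The two positions differ by \<open>to_nat (snd p) + 1\<close>, so both inequalities
  together bound the code of the label by \<open>2 * m\<close>.\<close>

lemma finite_common_positions:
  "finite {p :: int \<times> 'n::countable. \<bar>fst p - int (to_nat (snd p))\<bar> \<le> m \<and>
     \<bar>fst p - (2 * int (to_nat (snd p)) + 1)\<bar> \<le> m}" (is "finite ?A")
proof (rule finite_subset)
  show "?A \<subseteq> {- 3 * m..3 * m} \<times> (to_nat -` {..nat (2 * m)})" by auto
  show "finite ({- 3 * m..3 * m} \<times> (to_nat -` {..nat (2 * m)} :: 'n set))"
    by (intro finite_cartesian_product finite_vimageI) auto
qed

text \<open>Away from finitely many blocks, two elements of the base group act by powers of one
  common generator and hence commute, so their commutator has finite support.\<close>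

lemma fin_ab_normal_finite_supp:
  "fin_ab_normal perm_group (base_group E a) {f \<in> base_group E a. finite (supp f)}"
proof (rule fin_ab_normalI)
  show "subgroup {f \<in> base_group E a. finite (supp f)} perm_group"
    by (rule base_group_supp_subgroup) (auto intro: finite_subset)
  show "x \<otimes>\<^bsub>perm_group\<^esub> f \<otimes>\<^bsub>perm_group\<^esub> inv\<^bsub>perm_group\<^esub> x \<in> {f \<in> base_group E a. finite (supp f)}"
    if x: "x \<in> base_group E a" and f: "f \<in> {f \<in> base_group E a. finite (supp f)}" for x f
  proof -
    have "part (x \<circ> f \<circ> inv\<^bsub>perm_group\<^esub> x) p = id" if "part f p = id" for p
      using part_comp[OF base_group_inv[OF x]] part_comp[of f E a x] part_inv[OF x] f that by simp
    then have "supp (x \<circ> f \<circ> inv\<^bsub>perm_group\<^esub> x) \<subseteq> supp f" by (auto simp: supp_def)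
    then show ?thesis
      using x f by (auto simp: base_group_comp base_group_inv intro: finite_subset)
  qed
  have "x \<otimes>\<^bsub>perm_group\<^esub> y \<otimes>\<^bsub>perm_group\<^esub> inv\<^bsub>perm_group\<^esub> x \<otimes>\<^bsub>perm_group\<^esub> inv\<^bsub>perm_group\<^esub> y
      \<in> {f \<in> base_group E a. finite (supp f)}"
    if x: "x \<in> base_group E a" and y: "y \<in> base_group E a" for x y
  proof -
    obtain m1 where m1: "tame E a 0 (part x) m1 x"
      using x tree_group_tameE[of x E a] unfolding base_group_def by auto
    obtain m2 where m2: "tame E a 0 (part y) m2 y"
      using y tree_group_tameE[of y E a] unfolding base_group_def by auto
    define m where "m = max m1 m2"
    let ?c = "x \<circ> y \<circ> inv\<^bsub>perm_group\<^esub> x \<circ> inv\<^bsub>perm_group\<^esub> y"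
    have "part ?c p = id" if p: "m < \<bar>fst p - int (to_nat (snd p))\<bar> \<or>
        m < \<bar>fst p - (2 * int (to_nat (snd p)) + 1)\<bar>" for p
    proof -
      have "part x p \<circ> part y p = part y p \<circ> part x p"
        using p
      proof
        assume "m < \<bar>fst p - int (to_nat (snd p))\<bar>"
        then show ?thesis
          by (intro generate_singleton_commute[OF bij_branch[of E 1 "snd p"]]
              tameD(6)[OF m1] tameD(6)[OF m2]) (simp_all add: m_def)
      next
        assume "m < \<bar>fst p - (2 * int (to_nat (snd p)) + 1)\<bar>"
        then show ?thesis
          by (intro generate_singleton_commute[OF bij_shift[of 1]]
              tameD(7)[OF m1] tameD(7)[OF m2]) (simp_all add: m_def)
      qed
      moreover have "part ?c p =
          part x p \<circ> part y p \<circ> part (inv\<^bsub>perm_group\<^esub> x) p \<circ> part (inv\<^bsub>perm_group\<^esub> y) p"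
        using part_comp[OF base_group_inv[OF y]] part_comp[OF base_group_inv[OF x]] part_comp[OF y]
        by simp
      ultimately show ?thesis
        using part_inv[OF x, of p] part_inv[OF y, of p] by (metis comp_assoc comp_id)
    qed
    then have "supp ?c \<subseteq> {p. \<bar>fst p - int (to_nat (snd p))\<bar> \<le> m \<and>
        \<bar>fst p - (2 * int (to_nat (snd p)) + 1)\<bar> \<le> m}"
      unfolding supp_def by (smt (verit) mem_Collect_eq subsetI)
    then have "finite (supp ?c)" by (rule finite_subset) (rule finite_common_positions)
    then show ?thesis using x y by (simp add: base_group_comp base_group_inv)
  qed
  then show "(\<forall>x\<in>base_group E a. \<forall>y\<in>base_group E a. x \<otimes>\<^bsub>perm_group\<^esub> y \<otimes>\<^bsub>perm_group\<^esub>
      inv\<^bsub>perm_group\<^esub> x \<otimes>\<^bsub>perm_group\<^esub> inv\<^bsub>perm_group\<^esub> y \<in> {f \<in> base_group E a. finite (supp f)}) \<or>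
    (\<exists>C. finite C \<and> C \<subseteq> base_group E a \<and> (\<forall>x\<in>base_group E a. \<exists>c\<in>C.
      x \<otimes>\<^bsub>perm_group\<^esub> inv\<^bsub>perm_group\<^esub> c \<in> {f \<in> base_group E a. finite (supp f)}))"
    by (intro disjI1 ballI)
qed simp

lemma base_group_supp_empty:
  assumes "f \<in> base_group E a" "supp f = {}"
  shows "f = id"
proof
  have p: "part f p = id" for p using assms(2) unfolding supp_def by blast
  show "f \<omega> = id \<omega>" for \<omega>
    by (cases \<omega>) (simp_all add: base_group_apply[OF assms(1)] p)
qed

lemma countable_base_group: "countable (base_group E a)"
  using countable_tree_group by (rule countable_subset[rotated]) (auto simp: base_group_def)

text \<open>Blocks are added one at a time. Taking the part at the block with code \<open>n\<close>
  is a homomorphism to the group of a child, and its kernel is the previous stage.\<close>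

lemma elementary_amenable_base_supp:
  assumes EA: "\<And>b. E a b \<Longrightarrow> elementary_amenable (perm_group\<lparr>carrier := tree_group E b\<rparr>)"
  shows "elementary_amenable
    (perm_group\<lparr>carrier := {f \<in> base_group E a. supp f \<subseteq> {p. to_nat p < n}}\<rparr>)"
proof (induction n)
  case 0
  have "{f \<in> base_group E a. supp f \<subseteq> {p. to_nat p < (0::nat)}} \<subseteq> {id}"
    using base_group_supp_empty by auto
  then have "finite {f \<in> base_group E a. supp f \<subseteq> {p. to_nat p < (0::nat)}}"
    by (rule finite_subset) simp
  then show ?case
    by (intro elementary_amenable_finite perm.subgroup_imp_group base_group_supp_subgroup) auto
next
  case (Suc n)
  let ?B = "\<lambda>n::nat. {f \<in> base_group E a. supp f \<subseteq> {p. to_nat p < n}}"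
  show ?case
  proof (cases "\<exists>p :: int \<times> 'a. to_nat p = n \<and> E a (snd p)")
    case True
    then obtain p :: "int \<times> 'a" where p: "to_nat p = n" "E a (snd p)" by blast
    let ?G = "perm_group\<lparr>carrier := ?B (Suc n)\<rparr>" and ?H = "perm_group\<lparr>carrier := tree_group E (snd p)\<rparr>"
    have B: "subgroup (?B (Suc n)) perm_group" by (rule base_group_supp_subgroup) auto
    have hom: "group_hom ?G ?H (\<lambda>f. part f p)"
      by (intro group_hom.intro group_hom_axioms.intro perm.subgroup_imp_group tree_group_subgroup B)
         (auto simp: hom_def base_group_apply(3) part_comp)
    have "kernel ?G ?H (\<lambda>f. part f p) = ?B n"
    proof -
      have "supp f \<subseteq> {q. to_nat q < n} \<longleftrightarrow> supp f \<subseteq> {q. to_nat q < Suc n} \<and> p \<notin> supp f" for f :: "'a point \<Rightarrow> 'a point"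
        using p(1) by (auto simp: less_Suc_eq)
      then show ?thesis by (auto simp: kernel_def supp_def)
    qed
    moreover have "countable (carrier ?G)"
      using countable_base_group[of E a] by (auto intro: countable_subset[rotated])
    ultimately show ?thesis
      using elementary_amenable_hom[OF hom _ EA[OF p(2)]] Suc by simp
  next
    case False
    have "p \<notin> supp f" if "f \<in> base_group E a" "to_nat p = n" for f and p :: "int \<times> 'a"
    proof -
      have "\<not> E a (snd p)" using False that(2) by blast
      from base_group_apply(4)[OF that(1) this] show ?thesis unfolding supp_def by simp
    qed
    then have "?B (Suc n) = ?B n" by (force simp: less_Suc_eq)
    then show ?thesis using Suc by simp
  qed
qed

text \<open>The layers from the bottom up: finitely supported elements as an increasing union of the
  stages above, the base group with abelian quotient over them, and the integers through
  \<open>degree\<close>.\<close>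

lemma elementary_amenable_tree_group_step:
  assumes EA: "\<And>b. E a b \<Longrightarrow> elementary_amenable (perm_group\<lparr>carrier := tree_group E b\<rparr>)"
  shows "elementary_amenable (perm_group\<lparr>carrier := tree_group E a\<rparr>)"
proof -
  let ?K = "base_group E a" and ?B = "{f \<in> base_group E a. finite (supp f)}"
  let ?Bn = "\<lambda>n::nat. {f \<in> base_group E a. supp f \<subseteq> {p. to_nat p < n}}"
  note normB = fin_ab_normal_finite_supp[of E a]
  note subB = fin_ab_normalD(1)[OF normB]
  have cB: "countable ?B" using countable_base_group by (rule countable_subset[rotated]) auto
  have "elementary_amenable (perm_group\<lparr>carrier := ?B\<rparr>)"
  proof (rule elementary_amenable_incseq[OF perm.subgroup_imp_group[OF subB], of ?Bn])
    have fin: "finite {p :: int \<times> 'a. to_nat p < n}" for n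
      using finite_vimageI[of "{..<n}" "to_nat :: int \<times> 'a \<Rightarrow> nat"] by (simp add: vimage_def)
    show "subgroup (?Bn n) (perm_group\<lparr>carrier := ?B\<rparr>)" for n
      by (rule perm.subgroup_incl[OF base_group_supp_subgroup subB]) (auto intro: finite_subset[OF _ fin])
    show "incseq ?Bn" by (force simp: incseq_def)
    show "carrier (perm_group\<lparr>carrier := ?B\<rparr>) = (\<Union>n. ?Bn n)"
    proof -
      have "\<exists>n. supp f \<subseteq> {p. to_nat p < n}" if "finite (supp f)" for f :: "'a point \<Rightarrow> 'a point"
      proof -
        have "supp f \<subseteq> {p. to_nat p < Suc (Max (to_nat ` supp f))}"
          using that by (auto simp: less_Suc_eq_le)
        then show ?thesis by blast
      qed
      then show ?thesis by (auto intro: finite_subset[OF _ fin])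
    qed
    show "elementary_amenable ((perm_group\<lparr>carrier := ?B\<rparr>)\<lparr>carrier := ?Bn n\<rparr>)" for n
      using elementary_amenable_base_supp[OF EA] by simp
  qed (use cB in simp)
  moreover have "fin_ab_normal (perm_group\<lparr>carrier := ?K\<rparr>) ?K ?B"
    using perm.fin_ab_normal_restrict_iff[OF base_group_subgroup subset_refl] normB by blast
  ultimately have "elementary_amenable (perm_group\<lparr>carrier := ?K\<rparr>)"
    using group.elementary_amenable_fin_ab_normal[OF perm.subgroup_imp_group[OF base_group_subgroup[of E a]]]
      countable_base_group[of E a] by simp
  moreover have "elementary_amenable integer_group"
    by (rule elementary_amenable_abelian) (simp_all add: abelian_integer_group)
  ultimately show ?thesis
    using elementary_amenable_hom[OF group_hom_degree[of E a]] kernel_degree[of E a]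
      countable_tree_group[of E a] by simp
qed

lemma elementary_amenable_tree_group:
  assumes "Wellfounded.accp (\<lambda>b a. E a b) a"
  shows "elementary_amenable (perm_group\<lparr>carrier := tree_group E a\<rparr>)"
  using assms
proof (induction rule: accp.induct)
  case (accI a)
  show ?case by (rule elementary_amenable_tree_group_step) (rule accI.IH)
qed


section \<open>Ill-founded nodes\<close>

text \<open>Equivariance of \<open>j\<close>. Nothing is prescribed outside the image of
  \<open>j\<close>, so commutators need to be computed on one block only.\<close>

definition shadows :: "('x \<Rightarrow> 'x) \<Rightarrow> ('a \<Rightarrow> 'x) \<Rightarrow> ('a \<Rightarrow> 'a) \<Rightarrow> bool" where
  "shadows f j g \<longleftrightarrow> (\<forall>\<omega>. f (j \<omega>) = j (g \<omega>))"

lemma shadows_comp: "shadows f j g \<Longrightarrow> shadows f' j g' \<Longrightarrow> shadows (f \<circ> f') j (g \<circ> g')"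
  by (simp add: shadows_def)

lemma shadows_inv:
  assumes "shadows f j g" "bij f" "\<And>\<omega>. g (g' \<omega>) = \<omega>"
  shows "shadows (inv\<^bsub>perm_group\<^esub> f) j g'"
  unfolding shadows_def
proof
  fix \<omega>
  have "j \<omega> = f (j (g' \<omega>))" using assms(1,3) by (simp add: shadows_def)
  then show "(inv\<^bsub>perm_group\<^esub> f) (j \<omega>) = j (g' \<omega>)" using inv_perm_group_apply(2)[OF assms(2)] by simp
qed

lemma shadows_shift_pow:
  assumes "shadows f j (shift 1)"
  shows "shadows (f [^]\<^bsub>perm_group\<^esub> n) j (shift (int n))"
proof (induction n)
  case (Suc n)
  from shadows_comp[OF this assms] show ?case by (simp add: shadows_def add.commute)
qed (simp add: shadows_def)

text \<open>Pairs that act on an embedded copy of the points like the generators of an ill-founded node.\<close>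

definition shadow_pairs :: "('n::countable \<Rightarrow> 'n \<Rightarrow> bool) \<Rightarrow> ('x \<Rightarrow> 'x) set set" where
  "shadow_pairs E = {{f, g} | f g. bij f \<and> bij g \<and>
     (\<exists>a (j :: 'n point \<Rightarrow> 'x). \<not> Wellfounded.accp (\<lambda>b a. E a b) a \<and> inj j \<and>
       shadows f j (shift 1) \<and> shadows g j (branch E 1 a))}"

text \<open>If \<open>L/M\<close> is abelian, \<open>R = k\<close> works. If it is finite, two
  powers of \<open>f\<close> share a representative, so \<open>M\<close> contains
  \<open>f [^] r\<close> for some positive \<open>r\<close>; by normality the multiple
  \<open>R = r * k\<close> works.\<close>

lemma (in group) fin_ab_normal_commutator_pow:
  fixes k :: nat
  assumes L: "subgroup L G" and M: "fin_ab_normal G L M" and f: "f \<in> L"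
  obtains R where "k \<le> R" "\<And>z. z \<in> L \<Longrightarrow> z \<otimes> f [^] R \<otimes> inv z \<otimes> inv (f [^] R) \<in> M"
proof -
  have Lc: "x \<in> carrier G" if "x \<in> L" for x using subgroup.mem_carrier[OF L that] .
  note MD = fin_ab_normalD[OF M]
  have pow: "f [^] n \<in> L" for n :: nat
    using f by (induction n) (auto intro: subgroup.one_closed[OF L] subgroup.m_closed[OF L])
  show thesis
    using M
  proof (cases rule: fin_ab_normalE)
    case abelian
    show thesis
    proof (rule that[of k])
      show "z \<otimes> f [^] k \<otimes> inv z \<otimes> inv (f [^] k) \<in> M" if "z \<in> L" for z
        by (rule abelian[OF that pow])
    qed (rule order_refl)
  next
    case (finite C)
    have "\<forall>n::nat. \<exists>d. d \<in> C \<and> f [^] n \<otimes> inv d \<in> M"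
    proof
      show "\<exists>d. d \<in> C \<and> f [^] n \<otimes> inv d \<in> M" for n :: nat
        using finite(3)[OF pow[of n]] by blast
    qed
    from choice[OF this] obtain c where c: "\<And>n::nat. c n \<in> C" "\<And>n. f [^] n \<otimes> inv (c n) \<in> M"
      by blast
    have "\<not> inj c"
    proof
      assume "inj c"
      then have "infinite (range c)" by (rule range_inj_infinite)
      then show False using finite_subset[OF _ finite(1), of "range c"] c(1) by blast
    qed
    then obtain m n where "m < n" "c m = c n"
      by (metis injI linorder_neqE_nat)
    define r where "r = n - m"
    have r: "r > 0" "n = r + m" using \<open>m < n\<close> by (simp_all add: r_def)
    have cc: "c m \<in> carrier G" using c(1) finite(2) Lc by blast
    have fc: "f \<in> carrier G" using Lc[OF f] .
    have "(f [^] n \<otimes> inv (c m)) \<otimes> inv (f [^] m \<otimes> inv (c m)) \<in> M"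
      using c(2)[of n] c(2)[of m] \<open>c m = c n\<close> subgroup.m_closed[OF MD(1)] subgroup.m_inv_closed[OF MD(1)]
      by simp
    also have "(f [^] n \<otimes> inv (c m)) \<otimes> inv (f [^] m \<otimes> inv (c m)) = f [^] n \<otimes> inv (f [^] m)"
      using cc fc by (simp add: inv_mult_group m_assoc) (simp add: m_assoc[symmetric])
    also have "\<dots> = f [^] r"
      using fc by (simp add: r(2) nat_pow_mult[symmetric] m_assoc)
    finally have fr: "f [^] r \<in> M" .
    have "(f [^] r) [^] i \<in> M" for i :: nat
      using fr by (induction i) (auto intro: subgroup.one_closed[OF MD(1)] subgroup.m_closed[OF MD(1)])
    then have frk: "f [^] (r * k) \<in> M" using fc by (simp add: nat_pow_pow)
    have "z \<otimes> f [^] (r * k) \<otimes> inv z \<otimes> inv (f [^] (r * k)) \<in> M" if "z \<in> L" for z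
      using MD(3)[OF that frk] frk subgroup.m_closed[OF MD(1)] subgroup.m_inv_closed[OF MD(1)] by blast
    moreover have "k \<le> r * k" using r(1) by simp
    ultimately show thesis by (rule that[rotated])
  qed
qed

text \<open>The conjugate \<open>z\<close> of \<open>g\<close> acts on the block of \<open>(0, b)\<close> as a generator of the child \<open>b\<close>, while the
  conjugate of \<open>z\<close> by \<open>f [^] R\<close> acts trivially there, because \<open>p - R\<close> is negative.\<close>

lemma shadows_commutator:
  assumes f: "bij f" "shadows f j (shift 1)" and g: "bij g" "shadows g j (branch E 1 a)" and R: "p < R"
    and z: "z = inv\<^bsub>perm_group\<^esub> (f [^]\<^bsub>perm_group\<^esub> p) \<circ> g \<circ> f [^]\<^bsub>perm_group\<^esub> p"
    and p: "E a b" "p = to_nat b \<or> p = 2 * to_nat b + 1"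
  shows "shadows (z \<circ> f [^]\<^bsub>perm_group\<^esub> R \<circ> inv\<^bsub>perm_group\<^esub> z \<circ> inv\<^bsub>perm_group\<^esub> (f [^]\<^bsub>perm_group\<^esub> R))
    (j \<circ> (#) (0, b)) (if p = to_nat b then shift 1 else branch E 1 b)"
proof -
  have bp: "bij (f [^]\<^bsub>perm_group\<^esub> n)" for n :: nat
    using perm.nat_pow_closed[of f n] f(1) by simp
  have bz: "bij z"
    unfolding z using bp[of p] g(1) perm.inv_closed[of "f [^]\<^bsub>perm_group\<^esub> p"] by (simp add: bij_comp)
  have sp: "shadows (f [^]\<^bsub>perm_group\<^esub> n) j (shift (int n))" for n by (rule shadows_shift_pow[OF f(2)])
  have si: "shadows (inv\<^bsub>perm_group\<^esub> (f [^]\<^bsub>perm_group\<^esub> n)) j (shift (- int n))" for n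
    by (rule shadows_inv[OF sp bp]) simp
  have sz: "shadows z j (shift (- int p) \<circ> branch E 1 a \<circ> shift (int p))"
    unfolding z by (intro shadows_comp sp si g(2))
  have szi: "shadows (inv\<^bsub>perm_group\<^esub> z) j (shift (- int p) \<circ> branch E (- 1) a \<circ> shift (int p))"
    by (rule shadows_inv[OF sz bz]) (use branch_minus[of E "- 1" a] in simp)
  have "shadows (z \<circ> f [^]\<^bsub>perm_group\<^esub> R \<circ> inv\<^bsub>perm_group\<^esub> z \<circ> inv\<^bsub>perm_group\<^esub> (f [^]\<^bsub>perm_group\<^esub> R)) j
    ((shift (- int p) \<circ> branch E 1 a \<circ> shift (int p)) \<circ> shift (int R) \<circ>
      (shift (- int p) \<circ> branch E (- 1) a \<circ> shift (int p)) \<circ> shift (- int R))" (is "shadows ?v j ?\<gamma>")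
    by (intro shadows_comp sz szi sp si)
  moreover have "?\<gamma> ((0, b) # \<omega>) = (0, b) # (if p = to_nat b then shift 1 else branch E 1 b) \<omega>" for \<omega>
    using R p by auto
  ultimately show ?thesis by (simp add: shadows_def)
qed

lemma persistent_shadow_pairs:
  "persistent perm_group (shadow_pairs E :: ('x \<Rightarrow> 'x) set set)"
  unfolding persistent_def
proof (intro ballI)
  fix S :: "('x \<Rightarrow> 'x) set" assume "S \<in> shadow_pairs E"
  then obtain f g a j where S: "S = {f, g}" and bij: "bij f" "bij g"
    and a: "\<not> Wellfounded.accp (\<lambda>b a. E a b) a" and j: "inj j"
    and f: "shadows f j (shift 1)" and g: "shadows g j (branch E 1 a)"
    unfolding shadow_pairs_def by blast
  have Sc: "S \<subseteq> carrier perm_group" using bij by (simp add: S)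
  \<comment> \<open>Persistence is now checked for \<open>S\<close>: nontriviality follows since
    \<open>shift 1\<close> moves a point and \<open>j\<close> is injective; for kernels, an
    ill-founded child \<open>b\<close> replaces \<open>a\<close>.\<close>
  let ?L = "generate perm_group S"
  have L: "subgroup ?L perm_group" by (rule perm.generate_is_subgroup[OF Sc])
  have "f \<noteq> id"
  proof
    assume f_id: "f = id"
    have "j [(0, a)] = j (shift 1 [(0, a)])" using f unfolding shadows_def f_id id_apply by (rule spec)
    then show False using injD[OF j] by force
  qed
  obtain b where b: "E a b" "\<not> Wellfounded.accp (\<lambda>b a. E a b) b"
    using a by (meson accp.accI)
  have fL: "f \<in> ?L" and gL: "g \<in> ?L" by (auto simp: S intro: generate.incl)
  have "\<exists>S'\<in>shadow_pairs E. S' \<subseteq> M" if M: "fin_ab_normal perm_group ?L M" for M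
  proof -
    \<comment> \<open>The bound makes \<open>R\<close> exceed both positions \<open>to_nat b\<close>
      and \<open>2 * to_nat b + 1\<close> of the child.\<close>
    obtain R where R: "2 * to_nat b + 2 \<le> R"
      "\<And>z. z \<in> ?L \<Longrightarrow> z \<otimes>\<^bsub>perm_group\<^esub> f [^]\<^bsub>perm_group\<^esub> R \<otimes>\<^bsub>perm_group\<^esub>
        inv\<^bsub>perm_group\<^esub> z \<otimes>\<^bsub>perm_group\<^esub> inv\<^bsub>perm_group\<^esub> (f [^]\<^bsub>perm_group\<^esub> R) \<in> M"
      by (rule perm.fin_ab_normal_commutator_pow[OF L M fL, of "2 * to_nat b + 2"]) (rule that)
    \<comment> \<open>Conjugation by the power \<open>p\<close> brings what \<open>g\<close> does at
      position \<open>p\<close> to position 0, so both generators of \<open>b\<close> can be seen on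
      the same block.\<close>
    define z where "z p = inv\<^bsub>perm_group\<^esub> (f [^]\<^bsub>perm_group\<^esub> p) \<circ> g \<circ> f [^]\<^bsub>perm_group\<^esub> p" for p :: nat
    define v where "v p = z p \<circ> f [^]\<^bsub>perm_group\<^esub> R \<circ> inv\<^bsub>perm_group\<^esub> (z p) \<circ>
      inv\<^bsub>perm_group\<^esub> (f [^]\<^bsub>perm_group\<^esub> R)" for p
    have pow: "f [^]\<^bsub>perm_group\<^esub> n \<in> ?L" for n :: nat
    proof (induction n)
      case 0 show ?case using subgroup.one_closed[OF L] by (simp only: perm.nat_pow_0)
    next
      case (Suc n) then show ?case using subgroup.m_closed[OF L Suc fL] by (simp only: perm.nat_pow_Suc)
    qed
    have zL: "z p \<in> ?L" for p
      using subgroup.m_closed[OF L subgroup.m_closed[OF L subgroup.m_inv_closed[OF L pow[of p]] gL] pow[of p]]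
      by (simp add: z_def)
    have vM: "v p \<in> M" for p using R(2)[OF zL[of p]] by (simp add: v_def)
    have bv: "bij (v p)" for p
      using vM subgroup.subset[OF fin_ab_normalD(1)[OF M]] by auto
    have "shadows (v (to_nat b)) (j \<circ> (#) (0, b)) (shift 1)"
      using shadows_commutator[OF bij(1) f bij(2) g _ refl b(1), of "to_nat b" R] R(1)
      by (simp add: v_def z_def)
    moreover have "shadows (v (2 * to_nat b + 1)) (j \<circ> (#) (0, b)) (branch E 1 b)"
      using shadows_commutator[OF bij(1) f bij(2) g _ refl b(1), of "2 * to_nat b + 1" R] R(1)
      by (simp add: v_def z_def)
    \<comment> \<open>The copy of the points on which the new pair acts is the block of
      \<open>(0, b)\<close> inside the old copy.\<close>
    moreover have "inj (j \<circ> (#) (0, b))" 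
      by (rule inj_compose[OF j]) (simp add: inj_on_def)
    ultimately have "{v (to_nat b), v (2 * to_nat b + 1)} \<in> shadow_pairs E"
      unfolding shadow_pairs_def using bv b(2) by blast
    then show ?thesis by (rule bexI[rotated]) (simp add: vM)
  qed
  then show "finite S \<and> S \<subseteq> carrier perm_group \<and> \<not> S \<subseteq> {\<one>\<^bsub>perm_group\<^esub>} \<and>
      (\<forall>M. fin_ab_normal perm_group ?L M \<longrightarrow> (\<exists>S'\<in>shadow_pairs E. S' \<subseteq> M))"
    using Sc \<open>f \<noteq> id\<close> by (simp add: S)
qed

lemma elementary_amenable_tree_group_iff:
  "elementary_amenable (perm_group\<lparr>carrier := tree_group E a\<rparr>) \<longleftrightarrow>
     Wellfounded.accp (\<lambda>b a. E a b) a"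
proof (rule iffI[OF _ elementary_amenable_tree_group], rule ccontr)
  assume EA: "elementary_amenable (perm_group\<lparr>carrier := tree_group E a\<rparr>)"
    and a: "\<not> Wellfounded.accp (\<lambda>b a. E a b) a"
  have "{S \<in> shadow_pairs E. S \<subseteq> tree_group E a} = {}"
    by (rule elementary_amenable_persistent[OF EA
          perm.persistent_subgroup[OF tree_group_subgroup persistent_shadow_pairs]])
  \<comment> \<open>The generating pair is itself a member, with the identity as embedding.\<close>
  moreover have "{shift 1, branch E 1 a} \<in> shadow_pairs E"
    unfolding shadow_pairs_def using a bij_shift bij_branch
    by (intro CollectI exI[of _ "shift 1"] exI[of _ "branch E 1 a"] conjI exI[of _ a] exI[of _ "\<lambda>\<omega>. \<omega>"])
       (auto simp: shadows_def)
  ultimately show False using shift_in_tree_group branch_in_tree_group by blast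
qed

section \<open>The Borel reduction of well-foundedness\<close>

lemma measurable_branch:
  fixes E :: "'x \<Rightarrow> 'n::countable \<Rightarrow> 'n \<Rightarrow> bool"
  assumes E [measurable]: "\<And>a b. Measurable.pred M (\<lambda>x. E x a b)"
  shows "(\<lambda>x. branch (E x) k a \<omega>) \<in> M \<rightarrow>\<^sub>M count_space UNIV"
proof (induction \<omega> arbitrary: a)
  case (Cons p \<omega>)
  note [measurable] = Cons
  have "(\<lambda>x. if E x a (snd p) \<and> fst p = int (to_nat (snd p)) then shift k \<omega>
      else if E x a (snd p) \<and> fst p = 2 * int (to_nat (snd p)) + 1 then branch (E x) k (snd p) \<omega>
      else \<omega>) \<in> M \<rightarrow>\<^sub>M count_space UNIV"
    by measurable
  then show ?case by simp
qed simp

lemma measurable_word_act: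
  fixes E :: "'x \<Rightarrow> 'n::countable \<Rightarrow> 'n \<Rightarrow> bool"
  assumes E: "\<And>a b. Measurable.pred M (\<lambda>x. E x a b)"
  shows "(\<lambda>x. word_act (E x) a w \<omega>) \<in> M \<rightarrow>\<^sub>M count_space UNIV"
proof (induction w)
  case Nil
  then show ?case by (simp add: word_act_def)
next
  case (Cons l w)
  have act: "(\<lambda>x. act (E x) a l \<omega>) \<in> M \<rightarrow>\<^sub>M count_space UNIV" for \<omega>
  proof -
    obtain i s where l: "l = (i, s)" by (cases l)
    have "(\<lambda>x. branch (E x) k a \<omega>) \<in> M \<rightarrow>\<^sub>M count_space UNIV" for k
      by (rule measurable_branch[OF E])
    then show ?thesis unfolding l by (cases "i = 0"; cases "i = 1") simp_all
  qed
  have "(\<lambda>x. act (E x) a l (word_act (E x) a w \<omega>)) \<in> M \<rightarrow>\<^sub>M count_space UNIV"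
    by (rule measurable_compose_countable[OF act Cons])
  then show ?case by (simp add: word_act_def)
qed

text \<open>A word belongs to the kernel iff it fixes every point, and there are only countably many
  points.\<close>

lemma measurable_marked_tree_group:
  fixes E :: "'x \<Rightarrow> 'n::countable \<Rightarrow> 'n \<Rightarrow> bool"
  assumes E: "\<And>a b. Measurable.pred M (\<lambda>x. E x a b)"
  shows "(\<lambda>x. marked_tree_group (E x) a) \<in> M \<rightarrow>\<^sub>M marked_groups_borel"
proof (rule measurable_marked_groupsI)
  show "marked_tree_group (E x) a \<in> marked_groups" for x
    using marked_tree_group_normal by (simp add: marked_groups_def)
  fix w
  have [measurable]: "(\<lambda>x. word_act (E x) a w \<omega>) \<in> M \<rightarrow>\<^sub>M count_space UNIV" for \<omega>
    by (rule measurable_word_act[OF E])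
  have "Measurable.pred M (\<lambda>x. reduced w \<and> (\<forall>\<omega>. word_act (E x) a w \<omega> = \<omega>))"
    by measurable
  then show "Measurable.pred M (\<lambda>x. w \<in> marked_tree_group (E x) a)"
    by (simp add: marked_tree_group_def)
qed

lemma pred_branch_edge: "Measurable.pred baire_measure (\<lambda>e. branch_edge e v v')"
proof -
  have [measurable]: "(\<lambda>e. e i) \<in> baire_measure \<rightarrow>\<^sub>M count_space UNIV" for i
    by (rule measurable_component_singleton) simp
  have "(\<lambda>e. map e [0..<n]) \<in> baire_measure \<rightarrow>\<^sub>M count_space UNIV" for n
  proof (induction n)
    case (Suc n)
    note [measurable] = Suc
    have "(\<lambda>e. (map e [0..<n], e n)) \<in> baire_measure \<rightarrow>\<^sub>M count_space UNIV" by measurable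
    from measurable_compose[OF this, of "\<lambda>(u, k). u @ [k]" "count_space UNIV"]
    show ?case by simp
  qed simp
  from measurable_compose[OF this, of "\<lambda>u. to_nat (u, v')" "count_space UNIV"]
  have "(\<lambda>e. to_nat (map e [0..<length v'], v')) \<in> baire_measure \<rightarrow>\<^sub>M count_space UNIV"
    by simp
  \<comment> \<open>The argument at which \<open>e\<close> is evaluated depends on \<open>e\<close>
    too, but takes countably many values, so the evaluation is pieced together from countably many
    coordinates.\<close>
  then have "(\<lambda>e. e (to_nat (map e [0..<length v'], v'))) \<in> baire_measure \<rightarrow>\<^sub>M count_space UNIV"
    by (rule measurable_compose_countable[rotated]) measurable
  note [measurable] = this
  show ?thesis unfolding branch_edge_def by measurable
qed

text \<open>The reduction sends a code \<open>e\<close> to the marked group of the root of its tree.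
  All values are finitely generated, so the preimage of the intersection is exactly the set of
  well-founded codes.\<close>

theorem EG_fg_not_borel: "EG \<inter> fg_marked_groups \<notin> sets marked_groups_borel"
proof
  let ?f = "\<lambda>e. marked_tree_group (branch_edge e) []"
  assume "EG \<inter> fg_marked_groups \<in> sets marked_groups_borel"
  from measurable_sets[OF measurable_marked_tree_group[OF pred_branch_edge] this]
  have "?f -` (EG \<inter> fg_marked_groups) \<in> sets baire_measure" by (simp add: space_PiM PiE_UNIV_domain)
  moreover have "?f -` (EG \<inter> fg_marked_groups) =
      {e. Wellfounded.accp (\<lambda>v' v. branch_edge e v v') []}"
    using marked_tree_group_fg by (auto simp: marked_tree_group_EG_iff elementary_amenable_tree_group_iff)
  ultimately show False using accp_branch_edge_not_borel by simp
qed

theorem theorem1p3: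
  shows "(co_analytic_in marked_groups_borel EG \<and>
          EG \<notin> sets marked_groups_borel) \<and>
         (co_analytic_in fg_marked_groups_borel (EG \<inter> fg_marked_groups) \<and>
          EG \<inter> fg_marked_groups \<notin> sets fg_marked_groups_borel) \<and>
         (co_analytic_in marked_groups_borel (EG \<inter> fg_marked_groups) \<and>
          EG \<inter> fg_marked_groups \<notin> sets marked_groups_borel)"
proof (intro conjI)
  \<comment> \<open>If \<open>EG\<close> were Borel, so would be its intersection with the Borel set
    \<open>fg_marked_groups\<close>.\<close>
  show "EG \<notin> sets marked_groups_borel"
    using EG_fg_not_borel sets_fg_marked_groups by blast
  have "fg_marked_groups \<inter> space marked_groups_borel \<in> sets marked_groups_borel"
    using sets_fg_marked_groups fg_marked_groups_subset
    by (simp add: space_marked_groups_borel Int_absorb2)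
  from sets_restrict_space_iff[OF this] show "EG \<inter> fg_marked_groups \<notin> sets fg_marked_groups_borel"
    using EG_fg_not_borel by (simp add: fg_marked_groups_borel_def)
qed (fact co_analytic_EG co_analytic_EG_fg co_analytic_EG_in_fg EG_fg_not_borel)+

end
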